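(* Let $\Phi$ be a non-autonomous finite conformal iterated function system, with initial set $J\subset\mathbb R^d$, satisfying the open set condition, and let $E$ be its non-autonomous finite conformal set. Suppose that $\mathcal L^d(\partial J)=0$ and that $$\lim_{k\to+\infty}\frac{\log \underline c_k}{\log M_k}=0 .$$ Then the Hausdorff dimension of $E$ is given by $$\dim_{\rm H}E=s_* .$$
   Context: $\mathcal L^d$ is $d$-dimensional Lebesgue measure. Words. $\{I_k\}_{k\ge 1}$ is a sequence of index sets with $2\le \#I_k<\infty$. For $k\ge l\ge 1$, $\Sigma_l^k=\{u_l\cdots u_k: u_j\in I_j\}$; $\Sigma^k=\Sigma_1^k$, $\Sigma^0=\{\emptyset\}$, $\Sigma^*=\bigcup_{k\ge 0}\Sigma^k$. System. $J\subset\mathbb R^d$ is compact with non-empty interior and $\overline{\mathrm{int}(J)}=J$. For each $k\ge1$, $\Phi_k=\{\varphi_{k,i}\}_{i\in I_k}$ is a family of maps $\varphi_{k,i}:J\to J$. For $\mathbf u=u_l\cdots u_k\in\Sigma_l^k$, $\varphi_{\mathbf u}=\varphi_{l,u_l}\circ\cdots\circ\varphi_{k,u_k}$ (and $\varphi_\emptyset=\mathrm{id}$). $\Phi=\{\Phi_k\}_{k\ge1}$, together with a family $\{J_{\mathbf u}:\mathbf u\in\Sigma^*\}$ of closed subsets of $J$, is a non-autonomous finite iterated function system if: (i) there is $0<c<1$ with $|\varphi_{k,i}(x)-\varphi_{k,i}(y)|\le c|x-y|$ for all $k$, $i\in I_k$, $x,y\in J$; (ii) $J_\emptyset=J$ and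 $J_{\mathbf u i}\subset J_{\mathbf u}$ for all $\mathbf u\in\Sigma^{k-1}$, $i\in I_k$, $k\ge1$; (iii) for each $\mathbf u\in\Sigma^*$ there is $\omega_{\mathbf u}\in\mathbb R^d$ such that $J_{\mathbf u}=\Psi_{\mathbf u}(J)$ with $\Psi_{\mathbf u}=\varphi_{\mathbf u}+\omega_{\mathbf u}$. Its attractor is $E=\bigcap_{k\ge1}\bigcup_{\mathbf u\in\Sigma^k}J_{\mathbf u}$. The open set condition (OSC) means: for all $k\ge0$, $\mathbf u\in\Sigma^k$ and $i\ne j\in I_{k+1}$, $\mathrm{int}(J_{\mathbf ui})\cap\mathrm{int}(J_{\mathbf uj})=\emptyset$. Conformality. $\Phi$ is conformal (and $E$ is called a non-autonomous finite conformal set) if there is an open connected set $V\supset J$, independent of $k$, such that each $\varphi_{k,j}$ extends to a $C^1$ conformal diffeomorphism of $V$ into $V$ (the derivative at each point is a similarity linear map), and there is $C\ge1$ with $\|D\varphi_{\mathbf u}(x)\|\le C\|D\varphi_{\mathbf u}(y)\|$ for all $x,y\in V$ and all $\mathbf u\in\Sigma_l^k$, $k\ge l\ge1$. Here $\|D\varphi(x)\|$ is the scaling factor of $D\varphi(x)$ and $\|D\varphi\|=\sup_{x\in J}\|D\varphi(x)\|$. Put $M_k=\sup_{\mathbf u\in\Sigma^k}\|D\varphi_{\mathbf u}\|$ and $\underline c_k=\inf_{j\in I_k}\|D\varphi_{k,j}\|$. Lower pressure: $\underline P(t)=\liminf_{k\to\infty}\frac1k\log\sum_{\mathbf u\in\Sigma^k}\|D\varphi_{\mathbf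 u}\|^t$, and $s_*=\inf\{t:\underline P(t)<0\}=\sup\{t:\underline P(t)>0\}$. *)

theory Defs
  imports "HOL-Analysis.Analysis"
begin

text \<open>
  The two special cases implement the usual conventions \<open>|{}|^s = 0\<close> and \<open>0^0 = 1\<close> for a
  singleton; note that \<open>0 powr 0 = 0\<close>.
\<close>

definition diam_power :: "real \<Rightarrow> 'a::metric_space set \<Rightarrow> ennreal" where
  "diam_power s U =
     (if U = {} then 0 else if s = 0 then 1 else ennreal (diameter U powr s))"

text \<open>
  Members of a cover are required to be bounded because \<^const>\<open>diameter\<close> is real-valued and
  therefore unspecified on unbounded sets. Finite covers are included by padding with \<open>{}\<close>.
\<close>

definition hausdorff_premeasure :: "real \<Rightarrow> real \<Rightarrow> 'a::metric_space set \<Rightarrow> ennreal" where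
  "hausdorff_premeasure s \<delta> E =
     (INF U \<in> {U :: nat \<Rightarrow> 'a set. E \<subseteq> (\<Union>n. U n) \<and> (\<forall>n. bounded (U n) \<and> diameter (U n) \<le> \<delta>)}.
        \<Sum>n. diam_power s (U n))"

definition hausdorff_measure :: "real \<Rightarrow> 'a::metric_space set \<Rightarrow> ennreal" where
  "hausdorff_measure s E = (SUP \<delta> \<in> {0<..}. hausdorff_premeasure s \<delta> E)"

definition hausdorff_dim :: "'a::metric_space set \<Rightarrow> ereal" where
  "hausdorff_dim E = Inf (ereal ` {s. 0 \<le> s \<and> hausdorff_measure s E = 0})"

definition similarity_linear :: "('a::euclidean_space \<Rightarrow> 'a) \<Rightarrow> bool" where
  "similarity_linear L \<longleftrightarrow> linear L \<and> (\<exists>r>0. \<forall>v. norm (L v) = r * norm v)"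

definition scaling_factor :: "('a::euclidean_space \<Rightarrow> 'a) \<Rightarrow> real" where
  "scaling_factor L = (THE r. 0 \<le> r \<and> (\<forall>v. norm (L v) = r * norm v))"

lemma scaling_factor_eq:
  fixes L :: "'a::euclidean_space \<Rightarrow> 'a"
  assumes "0 \<le> r" and "\<And>v. norm (L v) = r * norm v"
  shows "scaling_factor L = r"
  unfolding scaling_factor_def
proof (rule the_equality)
  show "0 \<le> r \<and> (\<forall>v. norm (L v) = r * norm v)"
    using assms by blast
next
  fix r' assume r': "0 \<le> r' \<and> (\<forall>v. norm (L v) = r' * norm v)"
  obtain b :: 'a where "b \<in> Basis"
    using nonempty_Basis by blast
  then have "norm b = 1"
    by simp
  moreover have "r' * norm b = r * norm b"
    using r' assms(2) by metis
  ultimately show "r' = r"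
    by simp
qed

definition C1_on :: "('a::euclidean_space \<Rightarrow> 'a) \<Rightarrow> 'a set \<Rightarrow> bool" where
  "C1_on f V \<longleftrightarrow> (\<exists>f' :: 'a \<Rightarrow> 'a \<Rightarrow>\<^sub>L 'a.
     (\<forall>x\<in>V. (f has_derivative blinfun_apply (f' x)) (at x)) \<and> continuous_on V f')"

text \<open>\<open>f\<close> need not map onto \<open>V\<close>: it is a diffeomorphism onto its open image \<open>f ` V\<close>.\<close>

definition C1_conformal_diffeo_into :: "'a set \<Rightarrow> ('a::euclidean_space \<Rightarrow> 'a) \<Rightarrow> bool" where
  "C1_conformal_diffeo_into V f \<longleftrightarrow>
     f ` V \<subseteq> V \<and> inj_on f V \<and> open (f ` V) \<and>
     C1_on f V \<and> C1_on (inv_into V f) (f ` V) \<and>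
     (\<forall>x\<in>V. similarity_linear (frechet_derivative f (at x)))"

definition deriv_scale :: "('a::euclidean_space \<Rightarrow> 'a) \<Rightarrow> 'a \<Rightarrow> real" where
  "deriv_scale f x = scaling_factor (frechet_derivative f (at x))"

definition deriv_sup :: "'a set \<Rightarrow> ('a::euclidean_space \<Rightarrow> 'a) \<Rightarrow> real" where
  "deriv_sup J f = (SUP x\<in>J. deriv_scale f x)"

text \<open>
  Levels are numbered from 1, so \<open>I 0\<close> and \<open>\<phi> 0\<close> are irrelevant. \<open>words I l k\<close> is
  \<open>\<Sigma>\<^sub>l\<^sup>k\<close>, whose words have length \<open>k - l + 1\<close>; in particular \<open>words I 1 k\<close> is \<open>\<Sigma>\<^sup>k\<close>
  and \<open>words I 1 0 = {[]}\<close>.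
\<close>

definition words :: "(nat \<Rightarrow> 'i set) \<Rightarrow> nat \<Rightarrow> nat \<Rightarrow> 'i list set" where
  "words I l k = {u. length u = Suc k - l \<and> (\<forall>j<length u. u ! j \<in> I (l + j))}"

text \<open>\<open>word_map \<phi> l u\<close> is \<open>\<phi>\<^sub>u\<close> for a word \<open>u\<close> whose first letter is at level \<open>l\<close>.\<close>

primrec word_map :: "(nat \<Rightarrow> 'i \<Rightarrow> 'a \<Rightarrow> 'a) \<Rightarrow> nat \<Rightarrow> 'i list \<Rightarrow> 'a \<Rightarrow> 'a" where
  "word_map \<phi> l [] = id"
| "word_map \<phi> l (i # u) = \<phi> l i \<circ> word_map \<phi> (Suc l) u"

locale nonautonomous_ifs =
  fixes I :: "nat \<Rightarrow> 'i set"
    and \<phi> :: "nat \<Rightarrow> 'i \<Rightarrow> 'a::euclidean_space \<Rightarrow> 'a"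
    and J :: "'a set"
    and Jw :: "'i list \<Rightarrow> 'a set"
  assumes index_sets: "\<forall>k\<ge>1. finite (I k) \<and> 2 \<le> card (I k)"
    and compact_J: "compact J"
    and interior_J: "interior J \<noteq> {}"
    and regular_J: "closure (interior J) = J"
    and maps_J: "\<forall>k\<ge>1. \<forall>i\<in>I k. \<phi> k i ` J \<subseteq> J"
    and Jw_closed: "\<forall>u \<in> (\<Union>k. words I 1 k). closed (Jw u) \<and> Jw u \<subseteq> J"
    and contraction: "\<exists>c. 0 < c \<and> c < 1 \<and>
      (\<forall>k\<ge>1. \<forall>i\<in>I k. \<forall>x\<in>J. \<forall>y\<in>J. dist (\<phi> k i x) (\<phi> k i y) \<le> c * dist x y)"
    and Jw_Nil: "Jw [] = J"
    and Jw_nested: "\<forall>k\<ge>1. \<forall>u \<in> words I 1 (k - 1). \<forall>i\<in>I k. Jw (u @ [i]) \<subseteq> Jw u"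
    and Jw_translate: "\<forall>u \<in> (\<Union>k. words I 1 k). \<exists>\<omega>. Jw u = (\<lambda>x. word_map \<phi> 1 u x + \<omega>) ` J"

definition attractor :: "(nat \<Rightarrow> 'i set) \<Rightarrow> ('i list \<Rightarrow> 'a set) \<Rightarrow> 'a set" where
  "attractor I Jw = (\<Inter>k\<in>{1..}. \<Union>u \<in> words I 1 k. Jw u)"

definition open_set_condition ::
    "(nat \<Rightarrow> 'i set) \<Rightarrow> ('i list \<Rightarrow> 'a::topological_space set) \<Rightarrow> bool" where
  "open_set_condition I Jw \<longleftrightarrow>
     (\<forall>k. \<forall>u \<in> words I 1 k. \<forall>i \<in> I (Suc k). \<forall>j \<in> I (Suc k). i \<noteq> j \<longrightarrow>
        interior (Jw (u @ [i])) \<inter> interior (Jw (u @ [j])) = {})"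

text \<open>
  The maps \<open>\<phi> k i\<close> are total functions. The conditions of \<^locale>\<open>nonautonomous_ifs\<close> only
  concern their values on \<open>J\<close>; in the conformal case their values on \<open>V\<close> are those of the given
  conformal extensions, and their values off \<open>V\<close> are irrelevant.
\<close>

locale conformal_nonautonomous_ifs = nonautonomous_ifs +
  assumes conformal: "\<exists>V. open V \<and> connected V \<and> J \<subseteq> V \<and>
    (\<forall>k\<ge>1. \<forall>i\<in>I k. C1_conformal_diffeo_into V (\<phi> k i)) \<and>
    (\<exists>C\<ge>1. \<forall>l\<ge>1. \<forall>k\<ge>l. \<forall>u \<in> words I l k. \<forall>x\<in>V. \<forall>y\<in>V.
       deriv_scale (word_map \<phi> l u) x \<le> C * deriv_scale (word_map \<phi> l u) y)"

definition max_scale ::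
    "(nat \<Rightarrow> 'i set) \<Rightarrow> (nat \<Rightarrow> 'i \<Rightarrow> 'a::euclidean_space \<Rightarrow> 'a) \<Rightarrow> 'a set \<Rightarrow> nat \<Rightarrow> real" where
  "max_scale I \<phi> J k = (SUP u \<in> words I 1 k. deriv_sup J (word_map \<phi> 1 u))"

definition min_scale ::
    "(nat \<Rightarrow> 'i set) \<Rightarrow> (nat \<Rightarrow> 'i \<Rightarrow> 'a::euclidean_space \<Rightarrow> 'a) \<Rightarrow> 'a set \<Rightarrow> nat \<Rightarrow> real" where
  "min_scale I \<phi> J k = (INF i \<in> I k. deriv_sup J (\<phi> k i))"

definition lower_pressure ::
    "(nat \<Rightarrow> 'i set) \<Rightarrow> (nat \<Rightarrow> 'i \<Rightarrow> 'a::euclidean_space \<Rightarrow> 'a) \<Rightarrow> 'a set \<Rightarrow> real \<Rightarrow> ereal" where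
  "lower_pressure I \<phi> J t =
     liminf (\<lambda>k. ereal (1 / real k * ln (\<Sum>u \<in> words I 1 k. deriv_sup J (word_map \<phi> 1 u) powr t)))"

definition lower_pressure_zero ::
    "(nat \<Rightarrow> 'i set) \<Rightarrow> (nat \<Rightarrow> 'i \<Rightarrow> 'a::euclidean_space \<Rightarrow> 'a) \<Rightarrow> 'a set \<Rightarrow> ereal" where
  "lower_pressure_zero I \<phi> J = Inf (ereal ` {t. lower_pressure I \<phi> J t < 0})"

end

theory Submission
  imports Defs "HOL-Library.Sublist"
begin

text \<open>
  Write \<open>|u|\<close> for the scale \<open>\<parallel>D\<phi>\<^sub>u\<parallel>\<close> of a word \<open>u\<close> and \<open>S\<^sub>k(t)\<close> for the sum of \<open>|u|\<^sup>t\<close> over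
  the words of length \<open>k\<close>. Bounded distortion makes every set \<open>J\<^sub>u\<close> look like a copy of \<open>J\<close> of size
  \<open>|u|\<close>: its diameter is at most a constant times \<open>|u|\<close> (\<open>Jw_diameter\<close>) and it contains a ball of
  radius a constant times \<open>|u|\<close> (\<open>Jw_contains_ball\<close>). It also makes scales multiplicative up to a
  constant along concatenation of words.

  Upper bound. If the lower pressure at \<open>t\<close> is negative, then \<open>S\<^sub>k(t)\<close> is exponentially small for
  infinitely many \<open>k\<close>, so the natural covers of the attractor by the \<open>J\<^sub>u\<close> of those levels
  show that its \<open>t\<close>-dimensional Hausdorff measure vanishes (\<open>hausdorff_measure_attractor_zero\<close>).

  Lower bound. Let \<open>0 \<le> s < t\<close> with \<open>S\<^sub>k(t) \<ge> 1\<close> for all large \<open>k\<close>. The usual argument puts on the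
  attractor a limit of the measures giving \<open>u \<in> \<Sigma>\<^sup>n\<close> the mass \<open>|u|\<^sup>t / S\<^sub>n(t)\<close> and applies the mass
  distribution principle. Here no limit is taken: the attractor is compact, so a countable
  cover by open balls has a finite part that already covers all \<open>J\<^sub>u\<close> of some deep level \<open>n\<close>, and the
  finite weights of that level suffice. What is needed is the Frostman-type estimate
  \<open>ball_mass_le\<close>: the words \<open>u\<close> of level \<open>n\<close> with \<open>J\<^sub>u\<close> meeting a ball of radius \<open>r\<close>
  carry at most the fraction \<open>B r\<^sup>s\<close> of \<open>S\<^sub>n(t)\<close>.

  To prove it, stop each word \<open>u\<close> at its first prefix \<open>w\<close> with \<open>|w| \<le> r\<close>. The descendants of \<open>w\<close> carry
  at most a constant times the fraction \<open>|w|\<^sup>t \<le> r\<^sup>t\<close> (\<open>sum_descendants_le\<close>), so it remains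
  to count the stopping words near the ball. By the open set condition their \<open>J\<^sub>w\<close> contain disjoint balls
  of radius comparable to \<open>|w|\<close>, all within distance of order \<open>r\<close>. If \<open>|w|\<close> were comparable to \<open>r\<close>
  their number would be bounded. In general the last letter of \<open>w\<close> may make \<open>|w|\<close> much smaller than \<open>r\<close>,
  but, up to a constant, by a factor no smaller than the minimal scale of its level. The hypothesis on
  the ratio of logarithms says that for every \<open>\<epsilon> > 0\<close> this minimal scale is at least \<open>|w|\<^sup>\<epsilon>\<close> once \<open>w\<close> is
  long, so that \<open>|w|\<close> is at least of order \<open>r\<^sup>p\<close> for every \<open>p > 1\<close> and all small \<open>r\<close>.
  Comparing volumes then bounds the number of stopping words by a constant times \<open>r\<^sup>-\<^sup>q\<close> for any \<open>q > 0\<close>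
  (\<open>card_stopping_words_near_ball\<close>), and \<open>q = t - s\<close> gives the estimate.

  Finally, increasing the exponent lowers the pressure at a definite rate because the maps
  contract uniformly. Hence nonnegative pressure at \<open>t'\<close> forces \<open>S\<^sub>k(t) \<ge> 1\<close> eventually for every \<open>t < t'\<close>
  (\<open>eventually_level_sum_ge_1\<close>), and the two bounds meet at the zero of the pressure.
\<close>

section \<open>Similarities and derivative bounds\<close>

lemma similarity_linear_norm:
  fixes L :: "'a::euclidean_space \<Rightarrow> 'a"
  assumes "similarity_linear L"
  shows "0 < scaling_factor L" and "norm (L v) = scaling_factor L * norm v"
proof -
  obtain r where r: "r > 0" "\<forall>v. norm (L v) = r * norm v"
    using assms unfolding similarity_linear_def by blast
  then have "scaling_factor L = r"
    by (intro scaling_factor_eq) auto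
  then show "0 < scaling_factor L" and "norm (L v) = scaling_factor L * norm v"
    using r by auto
qed

lemma dist_le_of_derivative_bound:
  fixes f :: "'a::euclidean_space \<Rightarrow> 'a"
  assumes "convex S"
    and der: "\<And>x. x \<in> S \<Longrightarrow> \<exists>L. (f has_derivative L) (at x) \<and> (\<forall>v. norm (L v) \<le> B * norm v)"
    and "x \<in> S" "y \<in> S"
  shows "dist (f x) (f y) \<le> B * dist x y"
proof -
  obtain f' where f': "\<And>x. x \<in> S \<Longrightarrow> (f has_derivative f' x) (at x) \<and> (\<forall>v. norm (f' x v) \<le> B * norm v)"
    using der by metis
  have "norm (f x - f y) \<le> B * norm (x - y)"
  proof (rule differentiable_bound[OF \<open>convex S\<close> _ _ \<open>x \<in> S\<close> \<open>y \<in> S\<close>])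
    show "(f has_derivative f' z) (at z within S)" if "z \<in> S" for z
      using f'[OF that] has_derivative_at_withinI by blast
    show "onorm (f' z) \<le> B" if "z \<in> S" for z
      using f'[OF that] by (intro onorm_le) blast
  qed
  then show ?thesis
    by (simp add: dist_norm)
qed

text \<open>
  A quantitative open mapping statement. Let \<open>R\<close> be the distance from \<open>f a\<close> to the complement of the
  image. On the ball of radius \<open>R\<close> about \<open>f a\<close>, which is convex and lies in the image, the inverse of
  \<open>f\<close> is \<open>1/m\<close>-Lipschitz. If \<open>R < m \<rho>\<close>, it maps this ball into a compact ball strictly smaller than the
  domain, so the closed ball of radius \<open>R\<close> would still lie in the open image, against the choice of \<open>R\<close>.
\<close>

lemma image_ball_contains_ball:
  fixes f :: "'a::euclidean_space \<Rightarrow> 'a"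
  assumes "0 < m" "0 < \<rho>"
    and inj: "inj_on f (ball a \<rho>)"
    and der: "\<And>x. x \<in> ball a \<rho> \<Longrightarrow>
      \<exists>L. (f has_derivative L) (at x) \<and> (\<forall>v. m * norm v \<le> norm (L v))"
  shows "ball (f a) (m * \<rho>) \<subseteq> f ` ball a \<rho>"
proof (rule ccontr)
  let ?U = "f ` ball a \<rho>"
  assume not_sub: "\<not> ball (f a) (m * \<rho>) \<subseteq> ?U"
  have cont: "continuous_on (ball a \<rho>) f"
    by (rule continuous_at_imp_continuous_on) (meson der has_derivative_continuous)
  have "open ?U"
    using invariance_of_domain[OF cont _ inj] by simp
  then have "closed (- ?U)" "- ?U \<noteq> {}"
    using not_sub by blast+
  then obtain z where z: "z \<notin> ?U" "\<And>y. y \<notin> ?U \<Longrightarrow> dist (f a) z \<le> dist (f a) y"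
    by (rule distance_attains_inf[of "- ?U" "f a"]) blast
  define R where "R = dist (f a) z"
  obtain y where "y \<in> ball (f a) (m * \<rho>)" "y \<notin> ?U"
    using not_sub by blast
  then have "R < m * \<rho>"
    using z(2)[of y] unfolding R_def by simp
  have "z \<noteq> f a"
    using z(1) \<open>0 < \<rho>\<close> by auto
  then have "R > 0"
    by (simp add: R_def)
  have ball_U: "ball (f a) R \<subseteq> ?U"
    using z(2) unfolding R_def by (meson linorder_not_le mem_ball subsetI)
  define g where "g = inv_into (ball a \<rho>) f"
  have gf: "g (f x) = x" if "x \<in> ball a \<rho>" for x
    unfolding g_def using inj that by (rule inv_into_f_f)
  \<comment> \<open>The inverse function theorem turns the lower bound on the derivative of \<open>f\<close> into an upper
    bound on the derivative of the inverse.\<close>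
  have g_der: "\<exists>G. (g has_derivative G) (at y) \<and> (\<forall>v. norm (G v) \<le> 1 / m * norm v)"
    if "y \<in> ball (f a) R" for y
  proof -
    obtain x where x: "x \<in> ball a \<rho>" "y = f x"
      using \<open>y \<in> ball (f a) R\<close> ball_U by blast
    obtain f' where f': "\<And>x. x \<in> ball a \<rho> \<Longrightarrow>
        (f has_derivative f' x) (at x) \<and> (\<forall>v. m * norm v \<le> norm (f' x v))"
      using der by metis
    have lin: "linear (f' x)"
      using f'[OF x(1)] has_derivative_linear by blast
    have "v = 0" if "f' x v = 0" for v
    proof -
      have "m * norm v \<le> 0"
        using f'[OF x(1)] that by (metis norm_zero)
      then show ?thesis
        using \<open>0 < m\<close> by (simp add: mult_le_0_iff)
    qed
    then have "inj (f' x)"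
      using linear_injective_0[OF lin] by blast
    then obtain G where G: "linear G" "\<And>v. f' x (G v) = v"
      using linear_injective_isomorphism[OF lin] by blast
    have "(g has_derivative (\<lambda>_. G) x) (at (f x))"
      by (rule has_derivative_inverse_on[where S = "ball a \<rho>" and f' = f'])
        (use f' gf x G in \<open>auto simp: fun_eq_iff\<close>)
    moreover have "norm (G v) \<le> 1 / m * norm v" for v
    proof -
      have "m * norm (G v) \<le> norm v"
        using f'[OF x(1)] G(2)[of v] by metis
      then show ?thesis
        using \<open>0 < m\<close> by (simp add: field_simps)
    qed
    ultimately show ?thesis
      using x(2) by blast
  qed
  have "ball (f a) R \<subseteq> f ` cball a (R / m)"
  proof
    fix y assume y: "y \<in> ball (f a) R"
    have "dist (g (f a)) (g y) \<le> 1 / m * dist (f a) y"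
      by (rule dist_le_of_derivative_bound[OF convex_ball[of "f a" R] g_der _ y])
        (use \<open>R > 0\<close> in auto)
    also have "\<dots> \<le> R / m"
      using y \<open>0 < m\<close> by (auto simp: divide_right_mono)
    finally have "g y \<in> cball a (R / m)"
      using gf \<open>0 < \<rho>\<close> by simp
    moreover have "f (g y) = y"
      unfolding g_def using y ball_U by (intro f_inv_into_f) auto
    ultimately show "y \<in> f ` cball a (R / m)"
      by (metis imageI)
  qed
  moreover have "R / m < \<rho>"
    using \<open>R < m * \<rho>\<close> \<open>0 < m\<close> by (simp add: pos_divide_less_eq mult.commute)
  then have "cball a (R / m) \<subseteq> ball a \<rho>"
    by auto
  then have "closed (f ` cball a (R / m))"
    by (meson cont compact_cball compact_continuous_image compact_imp_closed continuous_on_subset)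
  ultimately have "closure (ball (f a) R) \<subseteq> f ` cball a (R / m)"
    by (simp add: closure_minimal)
  moreover have "z \<in> closure (ball (f a) R)"
    using \<open>R > 0\<close> by (simp add: R_def)
  ultimately show False
    using z(1) \<open>cball a (R / m) \<subseteq> ball a \<rho>\<close> by blast
qed

section \<open>Images of compact subsets of a domain\<close>

lemma nonneg_of_derivative_bound:
  fixes L :: "'a::euclidean_space \<Rightarrow> 'a"
  assumes "\<forall>v. norm (L v) \<le> B * norm v"
  shows "0 \<le> B"
proof -
  obtain b :: 'a where b: "b \<in> Basis"
    using nonempty_Basis by blast
  have "0 \<le> B * norm b"
    using assms norm_ge_zero order_trans by blast
  then show ?thesis
    using b by simp
qed

text \<open>
  The length of any path from \<open>a\<close> to \<open>x\<close> inside \<open>V\<close> is such an \<open>M\<close>; testing against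
  maps avoids speaking of paths.
\<close>

definition spread_bound :: "'a::euclidean_space set \<Rightarrow> 'a \<Rightarrow> 'a \<Rightarrow> real \<Rightarrow> bool" where
  "spread_bound V a x M \<longleftrightarrow> (\<forall>(f :: 'a \<Rightarrow> 'a) B.
     (\<forall>z\<in>V. \<exists>L. (f has_derivative L) (at z) \<and> (\<forall>v. norm (L v) \<le> B * norm v)) \<longrightarrow>
     dist (f a) (f x) \<le> M * B)"

lemma spread_bound_ball:
  assumes "spread_bound V a x M" "ball z e \<subseteq> V" "x \<in> ball z e" "y \<in> ball z e"
  shows "spread_bound V a y (M + 2 * e)"
  unfolding spread_bound_def
proof (intro allI impI)
  fix f :: "'a \<Rightarrow> 'a" and B
  assume der: "\<forall>z\<in>V. \<exists>L. (f has_derivative L) (at z) \<and> (\<forall>v. norm (L v) \<le> B * norm v)"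
  have "0 \<le> B"
    using der assms(2,3) nonneg_of_derivative_bound by blast
  have "dist (f x) (f y) \<le> B * dist x y"
    by (rule dist_le_of_derivative_bound[OF convex_ball[of z e]]) (use der assms in auto)
  also have "dist x y \<le> 2 * e"
    using assms(3,4) dist_triangle[of x y z] by (simp add: dist_commute)
  finally have "dist (f x) (f y) \<le> B * (2 * e)"
    using \<open>0 \<le> B\<close> by (simp add: mult_left_mono)
  moreover have "dist (f a) (f x) \<le> M * B"
    using assms(1) der unfolding spread_bound_def by blast
  ultimately show "dist (f a) (f y) \<le> (M + 2 * e) * B"
    using dist_triangle[of "f a" "f y" "f x"] by (simp add: algebra_simps)
qed

text \<open>
  On a convex set the mean value inequality suffices, but \<open>J\<close> need not even be connected, and joining
  its points needs the surrounding domain \<open>V\<close>. The points that can be reached from \<open>a\<close> with a uniform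
  bound form a set that is open and closed in \<open>V\<close>, because a small ball can be crossed at bounded
  cost; compactness of \<open>J\<close> makes the bound uniform.
\<close>

lemma compact_image_spread:
  fixes V :: "'a::euclidean_space set"
  assumes "open V" "connected V" "compact J" "J \<subseteq> V"
  obtains A where "0 < A"
    and "\<And>(f :: 'a \<Rightarrow> 'a) B x y. (\<And>z. z \<in> V \<Longrightarrow>
        \<exists>L. (f has_derivative L) (at z) \<and> (\<forall>v. norm (L v) \<le> B * norm v)) \<Longrightarrow>
      x \<in> J \<Longrightarrow> y \<in> J \<Longrightarrow> dist (f x) (f y) \<le> A * B"
proof (cases "J = {}")
  case True
  then show thesis
    using that[of 1] by simp
next
  case False
  then obtain a where a: "a \<in> V"
    using assms(4) by blast
  have near: "\<exists>e>0. ball x e \<subseteq> V" if "x \<in> V" for x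
    using \<open>open V\<close> that open_contains_ball by blast
  have reach: "\<exists>M. spread_bound V a x M" if "x \<in> V" for x
  proof (rule connected_induction_simple[OF \<open>connected V\<close> a that])
    show "\<exists>M. spread_bound V a a M"
      by (rule exI[of _ 0]) (simp add: spread_bound_def)
    fix z assume "z \<in> V"
    then obtain e where e: "e > 0" "ball z e \<subseteq> V"
      using near by blast
    show "\<exists>T. openin (top_of_set V) T \<and> z \<in> T \<and>
        (\<forall>x\<in>T. \<forall>y\<in>T. (\<exists>M. spread_bound V a x M) \<longrightarrow> (\<exists>M. spread_bound V a y M))"
    proof (intro exI[of _ "ball z e"] conjI ballI impI)
      show "openin (top_of_set V) (ball z e)"
        using e(2) by (simp add: open_subset)
      show "z \<in> ball z e"
        using e(1) by simp
    qed (meson spread_bound_ball e(2))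
  qed
  then obtain M where M: "\<And>x. x \<in> V \<Longrightarrow> spread_bound V a x (M x)"
    by metis
  obtain e where e: "\<And>x. x \<in> V \<Longrightarrow> e x > 0 \<and> ball x (e x) \<subseteq> V"
    using near by metis
  have "J \<subseteq> (\<Union>x\<in>J. ball x (e x))"
    using e assms(4) by force
  then obtain F where F: "F \<subseteq> J" "finite F" "J \<subseteq> (\<Union>x\<in>F. ball x (e x))"
    by (rule compactE_image[OF \<open>compact J\<close>, rotated]) auto
  define K where "K = (\<Sum>x\<in>F. \<bar>M x\<bar> + 2 * e x)"
  have K0: "0 \<le> K"
    unfolding K_def
  proof (rule sum_nonneg)
    fix x assume "x \<in> F"
    then have "e x > 0"
      using e F(1) assms(4) by blast
    then show "0 \<le> \<bar>M x\<bar> + 2 * e x"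
      by simp
  qed
  show thesis
  proof (rule that[of "2 * K + 1"])
    show "0 < 2 * K + 1"
      using K0 by simp
    fix f :: "'a \<Rightarrow> 'a" and B x y
    assume der: "\<And>z. z \<in> V \<Longrightarrow>
        \<exists>L. (f has_derivative L) (at z) \<and> (\<forall>v. norm (L v) \<le> B * norm v)"
      and xy: "x \<in> J" "y \<in> J"
    have "0 \<le> B"
      using der[OF a] nonneg_of_derivative_bound by blast
    have to_a: "dist (f a) (f u) \<le> K * B" if "u \<in> J" for u
    proof -
      obtain w where w: "w \<in> F" "u \<in> ball w (e w)"
        using F(3) \<open>u \<in> J\<close> by blast
      have wV: "w \<in> V"
        using w F assms(4) by blast
      have "spread_bound V a u (M w + 2 * e w)"
        by (rule spread_bound_ball[OF M[OF wV] _ _ w(2)]) (use e[OF wV] in auto)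
      then have "dist (f a) (f u) \<le> (M w + 2 * e w) * B"
        unfolding spread_bound_def using der by blast
      also have "M w + 2 * e w \<le> K"
      proof -
        have "\<bar>M w\<bar> + 2 * e w \<le> K"
          unfolding K_def
        proof (rule member_le_sum[OF w(1) _ F(2)])
          fix x assume "x \<in> F - {w}"
          then have "e x > 0"
            using e F(1) assms(4) by blast
          then show "0 \<le> \<bar>M x\<bar> + 2 * e x"
            by simp
        qed
        then show ?thesis
          by linarith
      qed
      finally show ?thesis
        using \<open>0 \<le> B\<close> by (simp add: mult_right_mono)
    qed
    have "dist (f x) (f y) \<le> dist (f a) (f x) + dist (f a) (f y)"
      by (simp add: dist_triangle3)
    also have "\<dots> \<le> 2 * (K * B)"
      using to_a[OF xy(1)] to_a[OF xy(2)] by simp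
    also have "\<dots> \<le> (2 * K + 1) * B"
      using \<open>0 \<le> B\<close> by (simp add: algebra_simps)
    finally show "dist (f x) (f y) \<le> (2 * K + 1) * B" .
  qed
qed

section \<open>Packing and covering\<close>

lemma card_disjoint_balls_le:
  fixes z :: "'w \<Rightarrow> 'a::euclidean_space"
  assumes "finite W" "0 < \<rho>" "0 \<le> R"
    and disj: "\<And>v w. v \<in> W \<Longrightarrow> w \<in> W \<Longrightarrow> v \<noteq> w \<Longrightarrow> ball (z v) \<rho> \<inter> ball (z w) \<rho> = {}"
    and sub: "\<And>w. w \<in> W \<Longrightarrow> ball (z w) \<rho> \<subseteq> ball y R"
  shows "real (card W) * \<rho> ^ DIM('a) \<le> R ^ DIM('a)"
proof -
  let ?c = "unit_ball_vol (real DIM('a))"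
  have "real (card W) * (?c * \<rho> ^ DIM('a)) = (\<Sum>w\<in>W. measure lborel (ball (z w) \<rho>))"
    using \<open>0 < \<rho>\<close> by (simp add: content_ball)
  also have "\<dots> = measure lborel (\<Union>w\<in>W. ball (z w) \<rho>)"
    using \<open>finite W\<close> disj
    by (intro measure_finite_Union[symmetric])
      (use emeasure_lborel_ball_finite in \<open>auto simp: disjoint_family_on_def less_top\<close>)
  also have "\<dots> \<le> measure lborel (ball y R)"
    using sub emeasure_lborel_ball_finite[of y R] \<open>finite W\<close>
    by (intro measure_mono_fmeasurable fmeasurableI) (auto intro!: borel_open)
  also have "\<dots> = ?c * R ^ DIM('a)"
    using \<open>0 \<le> R\<close> by (simp add: content_ball)
  finally have "?c * (real (card W) * \<rho> ^ DIM('a)) \<le> ?c * R ^ DIM('a)"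
    by (simp add: mult_ac)
  then show ?thesis
    by (simp add: unit_ball_vol_pos)
qed

text \<open>
  This replaces a member of a cover by an open ball around one of its points. Strict enlargement is also
  what deals with singletons, whose diameter is \<open>0\<close>; for \<open>s = 0\<close> the convention \<open>0\<^sup>0 = 1\<close> makes the bound
  trivial.
\<close>

lemma diam_power_enlarge:
  assumes "0 \<le> s" "bounded U" "U \<noteq> {}" "diameter U < \<delta>" "0 < \<eta>"
  obtains r where "diameter U < r" "r < \<delta>" "ennreal (r powr s) \<le> diam_power s U + ennreal \<eta>"
proof (cases "s = 0")
  case True
  obtain r where r: "diameter U < r" "r < \<delta>"
    using dense[OF assms(4)] by blast
  have "r > 0"
    using r(1) diameter_ge_0[OF assms(2)] by linarith
  show thesis
    by (rule that[OF r]) (use True assms \<open>r > 0\<close> in \<open>simp add: diam_power_def\<close>)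
next
  case False
  have D0: "0 \<le> diameter U"
    using diameter_ge_0[OF assms(2)] .
  have "((\<lambda>r. r powr s) \<longlongrightarrow> diameter U powr s) (at_right (diameter U))"
    using False assms(1) D0
    by (intro tendsto_powr' tendsto_intros) (auto simp: eventually_at_right_field intro!: exI[of _ "diameter U + 1"])
  then have "eventually (\<lambda>r. r powr s < diameter U powr s + \<eta>) (at_right (diameter U))"
    using \<open>0 < \<eta>\<close> by (intro order_tendstoD) auto
  moreover have "eventually (\<lambda>r. r \<in> {diameter U<..<\<delta>}) (at_right (diameter U))"
    using assms(4) by (rule eventually_at_right_real)
  ultimately have "eventually (\<lambda>r. r powr s < diameter U powr s + \<eta> \<and> r \<in> {diameter U<..<\<delta>}) (at_right (diameter U))"
    by (rule eventually_conj)
  then obtain r where r: "r powr s < diameter U powr s + \<eta>" "r \<in> {diameter U<..<\<delta>}"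
    using eventually_happens' trivial_limit_at_right_real by blast
  have "ennreal (r powr s) \<le> diam_power s U + ennreal \<eta>"
    using r False assms by (simp add: diam_power_def flip: ennreal_plus)
  then show thesis
    using that r(2) by auto
qed

lemma hausdorff_premeasure_le_finite_cover:
  fixes E :: "'a::metric_space set"
  assumes "0 < t" "0 \<le> \<delta>" "finite W" "E \<subseteq> (\<Union>w\<in>W. X w)"
    and X: "\<And>w. w \<in> W \<Longrightarrow> bounded (X w) \<and> diameter (X w) \<le> d w \<and> d w \<le> \<delta>"
  shows "hausdorff_premeasure t \<delta> E \<le> ennreal (\<Sum>w\<in>W. d w powr t)"
proof -
  obtain h where h: "bij_betw h {0..<card W} W"
    using ex_bij_betw_nat_finite[OF \<open>finite W\<close>] by blast
  define U where "U n = (if n < card W then X (h n) else {})" for n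
  have hW: "h n \<in> W" if "n < card W" for n
    using h that by (auto simp: bij_betw_def)
  have "(\<Union>w\<in>W. X w) \<subseteq> (\<Union>n. U n)"
  proof
    fix y assume "y \<in> (\<Union>w\<in>W. X w)"
    then obtain w where "w \<in> W" "y \<in> X w"
      by blast
    moreover obtain n where "n < card W" "h n = w"
      using bij_betw_imp_surj_on[OF h] \<open>w \<in> W\<close> by (metis atLeastLessThan_iff imageE)
    ultimately have "y \<in> U n"
      by (simp add: U_def)
    then show "y \<in> (\<Union>n. U n)"
      by blast
  qed
  moreover have "bounded (U n) \<and> diameter (U n) \<le> \<delta>" for n
    using X[OF hW[of n]] \<open>0 \<le> \<delta>\<close> by (auto simp: U_def)
  ultimately have "hausdorff_premeasure t \<delta> E \<le> (\<Sum>n. diam_power t (U n))"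
    unfolding hausdorff_premeasure_def using assms(4) by (intro INF_lower) auto
  also have "\<dots> = (\<Sum>n<card W. diam_power t (U n))"
    by (rule suminf_finite) (auto simp: U_def diam_power_def)
  also have "\<dots> \<le> (\<Sum>n<card W. ennreal (d (h n) powr t))"
  proof (rule sum_mono)
    fix n assume "n \<in> {..<card W}"
    then have n: "n < card W"
      by simp
    show "diam_power t (U n) \<le> ennreal (d (h n) powr t)"
      using X[OF hW[OF n]] n \<open>0 < t\<close> diameter_ge_0[of "X (h n)"]
      by (auto simp: U_def diam_power_def intro!: ennreal_leI powr_mono2)
  qed
  also have "\<dots> = ennreal (\<Sum>n<card W. d (h n) powr t)"
    by (rule sum_ennreal) simp
  also have "(\<Sum>n<card W. d (h n) powr t) = (\<Sum>w\<in>W. d w powr t)"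
    using sum.reindex_bij_betw[OF h, of "\<lambda>w. d w powr t"] by (simp add: lessThan_atLeast0)
  finally show ?thesis .
qed

lemma eventually_exp_decay_le:
  fixes D r e :: real
  assumes "r < 0" "0 < e"
  shows "eventually (\<lambda>k. D * exp (r * real k) \<le> e) sequentially"
proof -
  have "(\<lambda>k. D * exp (r * real k)) \<longlonglongrightarrow> D * 0"
    using \<open>r < 0\<close>
    by (intro tendsto_mult tendsto_const filterlim_compose[OF exp_at_bot]
        filterlim_tendsto_neg_mult_at_bot[OF tendsto_const _ filterlim_real_sequentially])
  then have "eventually (\<lambda>k. D * exp (r * real k) < e) sequentially"
    using \<open>0 < e\<close> by (intro order_tendstoD) auto
  then show ?thesis
    by (rule eventually_mono) simp
qed

section \<open>Conformal maps\<close>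

lemma similarity_linear_compose:
  fixes L K :: "'a::euclidean_space \<Rightarrow> 'a"
  assumes "similarity_linear L" "similarity_linear K"
  shows "similarity_linear (L \<circ> K)"
    and "scaling_factor (L \<circ> K) = scaling_factor L * scaling_factor K"
proof -
  have norm: "norm ((L \<circ> K) v) = scaling_factor L * scaling_factor K * norm v" for v
    using similarity_linear_norm(2)[OF assms(1)] similarity_linear_norm(2)[OF assms(2)] by simp
  moreover have pos: "0 < scaling_factor L * scaling_factor K"
    using similarity_linear_norm(1)[OF assms(1)] similarity_linear_norm(1)[OF assms(2)] by simp
  moreover have "linear (L \<circ> K)"
    using assms unfolding similarity_linear_def by (blast intro: linear_compose)
  ultimately show "similarity_linear (L \<circ> K)"
    unfolding similarity_linear_def by blast
  show "scaling_factor (L \<circ> K) = scaling_factor L * scaling_factor K"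
    by (rule scaling_factor_eq) (use pos norm in auto)
qed

definition conformal_at :: "('a::euclidean_space \<Rightarrow> 'a) \<Rightarrow> 'a \<Rightarrow> bool" where
  "conformal_at f x \<longleftrightarrow> f differentiable at x \<and> similarity_linear (frechet_derivative f (at x))"

lemma conformal_at_compose:
  fixes f g :: "'a::euclidean_space \<Rightarrow> 'a"
  assumes "conformal_at f (g x)" "conformal_at g x"
  shows "conformal_at (f \<circ> g) x" "deriv_scale (f \<circ> g) x = deriv_scale f (g x) * deriv_scale g x"
  using assms similarity_linear_compose differentiable_chain_at[of g x f]
  by (auto simp: conformal_at_def deriv_scale_def frechet_derivative_compose)

lemma conformal_at_id: "conformal_at id x" "deriv_scale id (x :: 'a::euclidean_space) = 1"
proof -
  have "frechet_derivative id (at x) = id"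
    using frechet_derivative_at[OF has_derivative_id] by (simp add: id_def)
  moreover have "id differentiable at x"
    using differentiable_def has_derivative_id by (metis id_def)
  moreover have "similarity_linear (id :: 'a \<Rightarrow> 'a)"
    unfolding similarity_linear_def by (auto simp: linear_id intro!: exI[of _ 1])
  moreover have "scaling_factor (id :: 'a \<Rightarrow> 'a) = 1"
    by (rule scaling_factor_eq) auto
  ultimately show "conformal_at id x" "deriv_scale id x = 1"
    unfolding conformal_at_def deriv_scale_def by simp_all
qed

lemma conformal_at_derivative:
  assumes "conformal_at f x"
  shows "0 < deriv_scale f x"
    and "\<exists>L. (f has_derivative L) (at x) \<and> (\<forall>v. norm (L v) = deriv_scale f x * norm v)"
proof -
  have der: "(f has_derivative frechet_derivative f (at x)) (at x)"
    using assms frechet_derivative_works unfolding conformal_at_def by blast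
  have sim: "similarity_linear (frechet_derivative f (at x))"
    using assms unfolding conformal_at_def by blast
  show "0 < deriv_scale f x"
    unfolding deriv_scale_def by (rule similarity_linear_norm(1)[OF sim])
  show "\<exists>L. (f has_derivative L) (at x) \<and> (\<forall>v. norm (L v) = deriv_scale f x * norm v)"
    using der similarity_linear_norm(2)[OF sim] unfolding deriv_scale_def by blast
qed

lemma deriv_scale_le_Lipschitz:
  fixes f :: "'a::euclidean_space \<Rightarrow> 'a"
  assumes conf: "conformal_at f x" and "0 < \<rho>"
    and lip: "\<And>y. y \<in> ball x \<rho> \<Longrightarrow> dist (f x) (f y) \<le> K * dist x y"
  shows "deriv_scale f x \<le> K"
proof (rule field_le_epsilon)
  fix e :: real assume "0 < e"
  obtain L where L: "(f has_derivative L) (at x)" "\<And>v. norm (L v) = deriv_scale f x * norm v"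
    using conformal_at_derivative(2)[OF conf] by blast
  obtain d where d: "d > 0" "\<And>y. norm (y - x) < d \<Longrightarrow> norm (f y - f x - L (y - x)) \<le> e * norm (y - x)"
    using L(1) \<open>0 < e\<close> unfolding has_derivative_at_alt by blast
  obtain b :: 'a where b: "b \<in> Basis"
    using nonempty_Basis by blast
  define h where "h = min d \<rho> / 2"
  have h: "0 < h" "h < d" "h < \<rho>"
    using d(1) \<open>0 < \<rho>\<close> unfolding h_def by auto
  define y where "y = x + h *\<^sub>R b"
  have y: "norm (y - x) = h"
    using h(1) b by (simp add: y_def)
  have "norm (L (y - x)) \<le> norm (f y - f x) + norm (f y - f x - L (y - x))"
    using norm_triangle_ineq2[of "L (y - x)" "f y - f x"] by (simp add: norm_minus_commute)
  also have "\<dots> \<le> K * h + e * h"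
    using lip[of y] d(2)[of y] y h by (simp add: dist_norm norm_minus_commute add_mono)
  finally have "deriv_scale f x * h \<le> (K + e) * h"
    using L(2)[of "y - x"] y by (simp add: algebra_simps)
  then show "deriv_scale f x \<le> K + e"
    using h(1) by simp
qed

section \<open>Words and bounded distortion\<close>

text \<open>
  The conformality and contraction hypotheses with their witnesses, the domain \<open>V\<close>, the distortion
  constant \<open>C\<close> and the contraction ratio \<open>c\<close>, made into parameters.
\<close>

locale conformal_ifs = nonautonomous_ifs I \<phi> J Jw
  for I :: "nat \<Rightarrow> 'i set"
    and \<phi> :: "nat \<Rightarrow> 'i \<Rightarrow> 'a::euclidean_space \<Rightarrow> 'a"
    and J :: "'a set"
    and Jw :: "'i list \<Rightarrow> 'a set" +
  fixes V :: "'a set" and C c :: real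
  assumes V: "open V" "connected V" "J \<subseteq> V"
    and diffeo: "\<And>k i. 1 \<le> k \<Longrightarrow> i \<in> I k \<Longrightarrow> C1_conformal_diffeo_into V (\<phi> k i)"
    and C: "1 \<le> C"
    and distortion: "\<And>l k u x y. 1 \<le> l \<Longrightarrow> l \<le> k \<Longrightarrow> u \<in> words I l k \<Longrightarrow> x \<in> V \<Longrightarrow> y \<in> V \<Longrightarrow>
      deriv_scale (word_map \<phi> l u) x \<le> C * deriv_scale (word_map \<phi> l u) y"
    and c: "0 < c" "c < 1"
    and contr: "\<And>k i x y. 1 \<le> k \<Longrightarrow> i \<in> I k \<Longrightarrow> x \<in> J \<Longrightarrow> y \<in> J \<Longrightarrow>
      dist (\<phi> k i x) (\<phi> k i y) \<le> c * dist x y"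
begin

text \<open>
  Unlike \<^const>\<open>words\<close>, this does not mention the length, which is what inductions on words need.
\<close>

definition level_word :: "nat \<Rightarrow> 'i list \<Rightarrow> bool" where
  "level_word l u \<longleftrightarrow> (\<forall>j<length u. u ! j \<in> I (l + j))"

abbreviation word_scale :: "nat \<Rightarrow> 'i list \<Rightarrow> real" where
  "word_scale l u \<equiv> deriv_sup J (word_map \<phi> l u)"

lemma level_word_Nil [simp]: "level_word l []"
  by (simp add: level_word_def)

lemma level_word_Cons [simp]: "level_word l (i # u) \<longleftrightarrow> i \<in> I l \<and> level_word (Suc l) u"
  by (auto simp: level_word_def nth_Cons less_Suc_eq_0_disj split: nat.splits)

lemma level_word_append [simp]:
  "level_word l (u @ v) \<longleftrightarrow> level_word l u \<and> level_word (l + length u) v"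
  by (induction u arbitrary: l) auto

lemma words_iff: "u \<in> words I l k \<longleftrightarrow> length u = Suc k - l \<and> level_word l u"
  by (simp add: words_def level_word_def)

lemma level_word_words: "level_word 1 u \<Longrightarrow> u \<in> words I 1 (length u)"
  by (simp add: words_iff)

lemma finite_words: "1 \<le> l \<Longrightarrow> finite (words I l k)"
proof (rule finite_subset)
  assume "1 \<le> l"
  show "words I l k \<subseteq> {u. set u \<subseteq> (\<Union>j\<in>{l..k}. I j) \<and> length u = Suc k - l}"
    by (force simp: words_def set_conv_nth)
  show "finite {u. set u \<subseteq> (\<Union>j\<in>{l..k}. I j) \<and> length u = Suc k - l}"
    using index_sets \<open>1 \<le> l\<close> by (intro finite_lists_length_eq) auto
qed

lemma I_nonempty: "1 \<le> k \<Longrightarrow> I k \<noteq> {}"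
  using index_sets by force

lemma words_nonempty: "words I 1 k \<noteq> {}"
proof -
  have "map (\<lambda>j. SOME i. i \<in> I (1 + j)) [0..<k] \<in> words I 1 k"
    using I_nonempty by (auto simp: words_def some_in_eq)
  then show ?thesis
    by blast
qed

lemma word_map_append: "word_map \<phi> l (u @ v) = word_map \<phi> l u \<circ> word_map \<phi> (l + length u) v"
  by (induction u arbitrary: l) (auto simp: o_assoc)

lemma letter_map:
  assumes "1 \<le> k" "i \<in> I k"
  shows "\<phi> k i ` V \<subseteq> V" "inj_on (\<phi> k i) V" "x \<in> V \<Longrightarrow> conformal_at (\<phi> k i) x"
  using diffeo[OF assms] unfolding C1_conformal_diffeo_into_def C1_on_def conformal_at_def
  by (auto intro: differentiableI)

lemma word_map_V:
  assumes "1 \<le> l" "level_word l u"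
  shows "word_map \<phi> l u ` V \<subseteq> V \<and> inj_on (word_map \<phi> l u) V \<and> (\<forall>x\<in>V. conformal_at (word_map \<phi> l u) x)"
  using assms
proof (induction u arbitrary: l)
  case Nil
  then show ?case
    using conformal_at_id(1)[unfolded id_def] by auto
next
  case (Cons i u)
  have IH: "word_map \<phi> (Suc l) u ` V \<subseteq> V" "inj_on (word_map \<phi> (Suc l) u) V"
      "\<And>x. x \<in> V \<Longrightarrow> conformal_at (word_map \<phi> (Suc l) u) x"
    using Cons.IH[of "Suc l"] Cons.prems by auto
  have i: "\<phi> l i ` V \<subseteq> V" "inj_on (\<phi> l i) V" "\<And>x. x \<in> V \<Longrightarrow> conformal_at (\<phi> l i) x"
    using letter_map[of l i] Cons.prems by auto
  have "inj_on (\<phi> l i \<circ> word_map \<phi> (Suc l) u) V"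
    using IH(2) inj_on_subset[OF i(2) IH(1)] by (rule comp_inj_on)
  moreover have "conformal_at (\<phi> l i \<circ> word_map \<phi> (Suc l) u) x" if "x \<in> V" for x
    using that IH(1) by (intro conformal_at_compose i IH(3)) auto
  moreover have "(\<phi> l i \<circ> word_map \<phi> (Suc l) u) ` V \<subseteq> V"
    using IH(1) i(1) by auto
  ultimately show ?case
    unfolding word_map.simps by blast
qed

lemma word_map_J:
  assumes "1 \<le> l" "level_word l u"
  shows "word_map \<phi> l u ` J \<subseteq> J \<and>
    (\<forall>x\<in>J. \<forall>y\<in>J. dist (word_map \<phi> l u x) (word_map \<phi> l u y) \<le> c ^ length u * dist x y)"
  using assms
proof (induction u arbitrary: l)
  case Nil
  then show ?case
    by simp
next
  case (Cons i u)
  have IH: "word_map \<phi> (Suc l) u ` J \<subseteq> J"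
      "\<And>x y. x \<in> J \<Longrightarrow> y \<in> J \<Longrightarrow>
        dist (word_map \<phi> (Suc l) u x) (word_map \<phi> (Suc l) u y) \<le> c ^ length u * dist x y"
    using Cons.IH[of "Suc l"] Cons.prems by auto
  have i: "\<phi> l i ` J \<subseteq> J"
    using maps_J Cons.prems by auto
  have "dist (\<phi> l i (word_map \<phi> (Suc l) u x)) (\<phi> l i (word_map \<phi> (Suc l) u y))
      \<le> c * (c ^ length u * dist x y)" if "x \<in> J" "y \<in> J" for x y
  proof -
    have "dist (\<phi> l i (word_map \<phi> (Suc l) u x)) (\<phi> l i (word_map \<phi> (Suc l) u y))
        \<le> c * dist (word_map \<phi> (Suc l) u x) (word_map \<phi> (Suc l) u y)"
      using that IH(1) Cons.prems by (intro contr) auto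
    also have "\<dots> \<le> c * (c ^ length u * dist x y)"
      using IH(2)[OF that] c(1) by simp
    finally show ?thesis .
  qed
  moreover have "(\<phi> l i \<circ> word_map \<phi> (Suc l) u) ` J \<subseteq> J"
    unfolding image_comp[symmetric] using IH(1) i by blast
  ultimately show ?case
    by (simp add: mult.assoc)
qed

lemma J_nonempty: "J \<noteq> {}"
  using interior_J interior_subset by blast

lemma deriv_scale_pos: "1 \<le> l \<Longrightarrow> level_word l u \<Longrightarrow> x \<in> V \<Longrightarrow> 0 < deriv_scale (word_map \<phi> l u) x"
  using word_map_V conformal_at_derivative(1) by blast

text \<open>
  Distortion is assumed for words of positive length only; the empty word gives the identity.
\<close>

lemma deriv_scale_distortion:
  assumes "1 \<le> l" "level_word l u" "x \<in> V" "y \<in> V"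
  shows "deriv_scale (word_map \<phi> l u) x \<le> C * deriv_scale (word_map \<phi> l u) y"
proof (cases "u = []")
  case True
  then show ?thesis
    using C by (simp add: conformal_at_id)
next
  case False
  then have "1 \<le> length u"
    by (simp add: Suc_leI)
  then show ?thesis
    using assms by (intro distortion[of l "l + length u - 1"]) (auto simp: words_iff)
qed

lemma deriv_scale_le_scale:
  assumes "1 \<le> l" "level_word l u" "x \<in> J"
  shows "deriv_scale (word_map \<phi> l u) x \<le> word_scale l u"
  unfolding deriv_sup_def
proof (rule cSUP_upper[OF assms(3)], rule bdd_aboveI2)
  fix y assume "y \<in> J"
  then show "deriv_scale (word_map \<phi> l u) y \<le> C * deriv_scale (word_map \<phi> l u) x"
    using deriv_scale_distortion assms V(3) by blast
qed

lemma scale_le_deriv_scale: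
  assumes "1 \<le> l" "level_word l u" "x \<in> V"
  shows "word_scale l u \<le> C * deriv_scale (word_map \<phi> l u) x"
  unfolding deriv_sup_def
  using assms V(3) J_nonempty by (intro cSUP_least deriv_scale_distortion) auto

lemma deriv_scale_le_C_scale:
  assumes "1 \<le> l" "level_word l u" "x \<in> V"
  shows "deriv_scale (word_map \<phi> l u) x \<le> C * word_scale l u"
proof -
  obtain y where y: "y \<in> J"
    using J_nonempty by blast
  have "deriv_scale (word_map \<phi> l u) x \<le> C * deriv_scale (word_map \<phi> l u) y"
    using deriv_scale_distortion assms y V(3) by blast
  also have "\<dots> \<le> C * word_scale l u"
    using deriv_scale_le_scale[OF assms(1,2) y] C by simp
  finally show ?thesis .
qed

lemma scale_pos: "1 \<le> l \<Longrightarrow> level_word l u \<Longrightarrow> 0 < word_scale l u"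
  using deriv_scale_pos deriv_scale_le_scale J_nonempty V(3)
  by (meson all_not_in_conv less_le_trans subsetD)

text \<open>
  The contraction bounds the derivative only at interior points of \<open>J\<close>, where difference quotients
  in all directions stay in \<open>J\<close>; distortion carries the bound to all of \<open>J\<close> at the cost of \<open>C\<close>.
\<close>

lemma scale_le_power:
  assumes "1 \<le> l" "level_word l u"
  shows "word_scale l u \<le> C * c ^ length u"
proof -
  obtain p \<rho> where p: "0 < \<rho>" "ball p \<rho> \<subseteq> J"
    using interior_J by (metis all_not_in_conv mem_interior)
  then have pJ: "p \<in> J"
    by auto
  have "deriv_scale (word_map \<phi> l u) p \<le> c ^ length u"
    by (rule deriv_scale_le_Lipschitz[OF _ p(1)]) (use word_map_V word_map_J assms p pJ V(3) in blast)+
  moreover have "word_scale l u \<le> C * deriv_scale (word_map \<phi> l u) p"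
    using scale_le_deriv_scale assms pJ V(3) by blast
  ultimately show ?thesis
    using C by (meson mult_left_mono order_trans zero_le_one)
qed

lemma deriv_scale_append:
  assumes "1 \<le> l" "level_word l (u @ v)" "x \<in> V"
  shows "deriv_scale (word_map \<phi> l (u @ v)) x =
    deriv_scale (word_map \<phi> l u) (word_map \<phi> (l + length u) v x) * deriv_scale (word_map \<phi> (l + length u) v) x"
  unfolding word_map_append
  using assms word_map_V[of l u] word_map_V[of "l + length u" v]
  by (intro conformal_at_compose) auto

lemma scale_append_le:
  assumes "1 \<le> l" "level_word l (u @ v)"
  shows "word_scale l (u @ v) \<le> word_scale l u * word_scale (l + length u) v"
  unfolding deriv_sup_def[of J "word_map \<phi> l (u @ v)"]
proof (rule cSUP_least[OF J_nonempty])
  fix x assume x: "x \<in> J"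
  have "word_map \<phi> (l + length u) v x \<in> J"
    using word_map_J[of "l + length u" v] assms x by auto
  then show "deriv_scale (word_map \<phi> l (u @ v)) x \<le> word_scale l u * word_scale (l + length u) v"
    unfolding deriv_scale_append[OF assms subsetD[OF V(3) x]]
    using assms x V(3) deriv_scale_pos[of "l + length u" v x] scale_pos[of l u]
    by (intro mult_mono deriv_scale_le_scale) auto
qed

lemma scale_append_ge:
  assumes "1 \<le> l" "level_word l (u @ v)"
  shows "word_scale l u * word_scale (l + length u) v \<le> C * word_scale l (u @ v)"
proof -
  have uv: "level_word l u" "level_word (l + length u) v" "1 \<le> l + length u"
    using assms by auto
  have pos: "0 < word_scale l u"
    using scale_pos assms(1) uv by blast
  have "word_scale (l + length u) v \<le> C * word_scale l (u @ v) / word_scale l u"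
    unfolding deriv_sup_def[of J "word_map \<phi> (l + length u) v"]
  proof (rule cSUP_least[OF J_nonempty])
    fix x assume x: "x \<in> J"
    let ?y = "word_map \<phi> (l + length u) v x"
    have y: "?y \<in> V"
      using word_map_V[of "l + length u" v] uv x V(3) by auto
    have "word_scale l u * deriv_scale (word_map \<phi> (l + length u) v) x
        \<le> (C * deriv_scale (word_map \<phi> l u) ?y) * deriv_scale (word_map \<phi> (l + length u) v) x"
      using scale_le_deriv_scale[OF assms(1) uv(1) y] deriv_scale_pos[OF uv(3,2), of x] x V(3)
      by (intro mult_right_mono) auto
    also have "\<dots> = C * deriv_scale (word_map \<phi> l (u @ v)) x"
      using assms x V(3) by (subst deriv_scale_append) auto
    also have "\<dots> \<le> C * word_scale l (u @ v)"
      using deriv_scale_le_scale[OF assms x] C by simp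
    finally show "deriv_scale (word_map \<phi> (l + length u) v) x \<le> C * word_scale l (u @ v) / word_scale l u"
      using pos by (simp add: pos_le_divide_eq mult.commute)
  qed
  then show ?thesis
    using pos by (simp add: pos_le_divide_eq mult.commute)
qed

section \<open>Shape of the basic sets\<close>

lemma Jw_word: "level_word 1 u \<Longrightarrow> \<exists>\<omega>. Jw u = (\<lambda>x. word_map \<phi> 1 u x + \<omega>) ` J"
  using Jw_translate level_word_words by blast

lemma Jw_nonempty: "level_word 1 u \<Longrightarrow> Jw u \<noteq> {}"
  using Jw_word J_nonempty by fastforce

lemma Jw_compact: "level_word 1 u \<Longrightarrow> compact (Jw u)"
  by (meson Jw_closed UN_I UNIV_I bounded_subset compact_J compact_eq_bounded_closed level_word_words)

lemma Jw_append_subset: "level_word 1 (u @ v) \<Longrightarrow> Jw (u @ v) \<subseteq> Jw u"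
proof (induction v rule: rev_induct)
  case (snoc i v)
  then have "Jw ((u @ v) @ [i]) \<subseteq> Jw (u @ v)"
    using Jw_nested[rule_format, of "Suc (length (u @ v))" "u @ v" i] level_word_words[of "u @ v"]
    by simp
  then show ?case
    using snoc by auto
qed simp

lemma Jw_diameter:
  obtains A where "0 < A"
    and "\<And>u x y. level_word 1 u \<Longrightarrow> x \<in> Jw u \<Longrightarrow> y \<in> Jw u \<Longrightarrow> dist x y \<le> A * word_scale 1 u"
proof -
  obtain A where A: "0 < A"
    and spread: "\<And>(f :: 'a \<Rightarrow> 'a) B x y. (\<And>z. z \<in> V \<Longrightarrow>
        \<exists>L. (f has_derivative L) (at z) \<and> (\<forall>v. norm (L v) \<le> B * norm v)) \<Longrightarrow>
      x \<in> J \<Longrightarrow> y \<in> J \<Longrightarrow> dist (f x) (f y) \<le> A * B"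
    using compact_image_spread[OF V(1,2) compact_J V(3)] by blast
  show thesis
  proof (rule that[of "A * C"])
    show "0 < A * C"
      using A C by simp
    fix u x y assume u: "level_word 1 u" and xy: "x \<in> Jw u" "y \<in> Jw u"
    obtain \<omega> where "Jw u = (\<lambda>x. word_map \<phi> 1 u x + \<omega>) ` J"
      using Jw_word[OF u] by blast
    then obtain x' y' where "x' \<in> J" "y' \<in> J" "x = word_map \<phi> 1 u x' + \<omega>" "y = word_map \<phi> 1 u y' + \<omega>"
      using xy by auto
    moreover have "\<exists>L. (word_map \<phi> 1 u has_derivative L) (at z) \<and> (\<forall>v. norm (L v) \<le> (C * word_scale 1 u) * norm v)"
      if "z \<in> V" for z
    proof -
      obtain L where "(word_map \<phi> 1 u has_derivative L) (at z)"
          "\<forall>v. norm (L v) = deriv_scale (word_map \<phi> 1 u) z * norm v"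
        using conformal_at_derivative(2) word_map_V[of 1 u] u \<open>z \<in> V\<close> by blast
      then show ?thesis
        using deriv_scale_le_C_scale[of 1 u z] u \<open>z \<in> V\<close> by (auto intro!: exI[of _ L] mult_right_mono)
    qed
    ultimately show "dist x y \<le> A * C * word_scale 1 u"
      using spread[of "word_map \<phi> 1 u" "C * word_scale 1 u" x' y'] by (simp add: mult.assoc)
  qed
qed

lemma Jw_contains_ball:
  obtains a where "0 < a"
    and "\<And>u. level_word 1 u \<Longrightarrow> \<exists>z. ball z (a * word_scale 1 u) \<subseteq> Jw u"
proof -
  obtain p \<rho> where p: "0 < \<rho>" "ball p \<rho> \<subseteq> J"
    using interior_J by (metis all_not_in_conv mem_interior)
  show thesis
  proof (rule that[of "\<rho> / C"])
    show "0 < \<rho> / C"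
      using p C by simp
    fix u assume u: "level_word 1 u"
    obtain \<omega> where \<omega>: "Jw u = (\<lambda>x. word_map \<phi> 1 u x + \<omega>) ` J"
      using Jw_word[OF u] by blast
    let ?m = "word_scale 1 u / C"
    have "ball (word_map \<phi> 1 u p) (?m * \<rho>) \<subseteq> word_map \<phi> 1 u ` ball p \<rho>"
    proof (rule image_ball_contains_ball[OF _ p(1)])
      show "0 < ?m"
        using scale_pos[of 1 u] u C by simp
      show "inj_on (word_map \<phi> 1 u) (ball p \<rho>)"
        using word_map_V[of 1 u] u p(2) V(3) by (meson inj_on_subset order_trans order_refl)
      fix x assume "x \<in> ball p \<rho>"
      then have x: "x \<in> V"
        using p(2) V(3) by blast
      obtain L where "(word_map \<phi> 1 u has_derivative L) (at x)"
          "\<forall>v. norm (L v) = deriv_scale (word_map \<phi> 1 u) x * norm v"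
        using conformal_at_derivative(2) word_map_V[of 1 u] u x by blast
      moreover have "?m \<le> deriv_scale (word_map \<phi> 1 u) x"
        using scale_le_deriv_scale[of 1 u x] u x C by (simp add: pos_divide_le_eq mult.commute)
      ultimately show "\<exists>L. (word_map \<phi> 1 u has_derivative L) (at x) \<and> (\<forall>v. ?m * norm v \<le> norm (L v))"
        by (metis mult_right_mono norm_ge_zero)
    qed
    then have "(\<lambda>x. x + \<omega>) ` ball (word_map \<phi> 1 u p) (?m * \<rho>) \<subseteq> Jw u"
      unfolding \<omega> using p(2) by force
    moreover have "(\<lambda>x. x + \<omega>) ` ball (word_map \<phi> 1 u p) (?m * \<rho>) =
        ball (word_map \<phi> 1 u p + \<omega>) (?m * \<rho>)"
      using ball_translation[of \<omega> "word_map \<phi> 1 u p" "?m * \<rho>"] by (simp add: add.commute)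
    moreover have "?m * \<rho> = \<rho> / C * word_scale 1 u"
      by simp
    ultimately show "\<exists>z. ball z (\<rho> / C * word_scale 1 u) \<subseteq> Jw u"
      by metis
  qed
qed

text \<open>
  Incomparable words branch at some letter, where the open set condition separates the two
  ancestors and hence the descendants.
\<close>

lemma interior_Jw_disjoint:
  assumes "open_set_condition I Jw" "level_word 1 u" "level_word 1 v" "u \<parallel> v"
  shows "interior (Jw u) \<inter> interior (Jw v) = {}"
proof -
  obtain w i u' j v' where w: "i \<noteq> j" "u = w @ i # u'" "v = w @ j # v'"
    using parallel_decomp[OF assms(4)] by blast
  have "interior (Jw (w @ [i])) \<inter> interior (Jw (w @ [j])) = {}"
    using assms w level_word_words[of w] unfolding open_set_condition_def by auto
  moreover have "Jw u \<subseteq> Jw (w @ [i])" "Jw v \<subseteq> Jw (w @ [j])"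
    using Jw_append_subset[of "w @ [i]" u'] Jw_append_subset[of "w @ [j]" v'] assms w by auto
  ultimately show ?thesis
    using interior_mono by blast
qed

section \<open>Level sums\<close>

definition level_sum :: "real \<Rightarrow> nat \<Rightarrow> real" where
  "level_sum t k = (\<Sum>u\<in>words I 1 k. word_scale 1 u powr t)"

lemma level_sum_pos: "0 < level_sum t k"
  unfolding level_sum_def
proof (rule sum_pos[OF finite_words words_nonempty])
  show "0 < word_scale 1 u powr t" if "u \<in> words I 1 k" for u
    using scale_pos[of 1 u] that by (simp add: words_iff)
qed simp

lemma sum_words_split:
  assumes "k \<le> n"
  shows "(\<Sum>u\<in>words I 1 n. f u) = (\<Sum>u\<in>words I 1 k. \<Sum>v\<in>words I (Suc k) n. f (u @ v))"
proof -
  have "bij_betw (\<lambda>(u, v). u @ v) (words I 1 k \<times> words I (Suc k) n) (words I 1 n)"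
  proof (rule bij_betw_byWitness[where f' = "\<lambda>u. (take k u, drop k u)"])
    show "(\<lambda>(u, v). u @ v) ` (words I 1 k \<times> words I (Suc k) n) \<subseteq> words I 1 n"
      using assms by (auto simp: words_iff)
    show "(\<lambda>u. (take k u, drop k u)) ` words I 1 n \<subseteq> words I 1 k \<times> words I (Suc k) n"
    proof safe
      fix u assume u: "u \<in> words I 1 n"
      then have "level_word 1 (take k u @ drop k u)" "length u = n"
        by (auto simp: words_iff)
      then show "take k u \<in> words I 1 k" "drop k u \<in> words I (Suc k) n"
        unfolding level_word_append using assms by (auto simp: words_iff)
    qed
  qed (auto simp: words_iff)
  then show ?thesis
    by (simp add: sum.cartesian_product sum.reindex_bij_betw[symmetric] case_prod_unfold)
qed

text \<open>
  Multiplicativity up to \<open>C\<close> makes the descendants of every word \<open>w\<close> of level \<open>k\<close> carry roughly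
  \<open>|w|\<^sup>t T\<close>, with the same tail sum \<open>T\<close> for all \<open>w\<close>. So the share of \<open>w\<close> in the level sum \<open>S\<^sub>n(t)\<close> is
  at most \<open>C\<^sup>t |w|\<^sup>t / S\<^sub>k(t)\<close>.
\<close>

lemma sum_descendants_le:
  assumes "0 \<le> t" "k \<le> n" "1 \<le> level_sum t k" "w \<in> words I 1 k"
  shows "(\<Sum>v\<in>words I (Suc k) n. word_scale 1 (w @ v) powr t) \<le> C powr t * word_scale 1 w powr t * level_sum t n"
proof -
  define T where "T = (\<Sum>v\<in>words I (Suc k) n. word_scale (Suc k) v powr t)"
  have T0: "0 \<le> T"
    unfolding T_def by (intro sum_nonneg) simp
  have "(\<Sum>v\<in>words I (Suc k) n. word_scale 1 (w @ v) powr t) \<le> word_scale 1 w powr t * T"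
    unfolding T_def sum_distrib_left
  proof (rule sum_mono)
    fix v assume v: "v \<in> words I (Suc k) n"
    then have "level_word 1 (w @ v)" "1 + length w = Suc k"
      using assms by (auto simp: words_iff)
    then have "word_scale 1 (w @ v) \<le> word_scale 1 w * word_scale (Suc k) v" "0 < word_scale 1 (w @ v)"
        "0 < word_scale 1 w" "0 < word_scale (Suc k) v"
      using scale_append_le[of 1 w v] scale_pos[of 1] scale_pos[of "Suc k" v] by auto
    then show "word_scale 1 (w @ v) powr t \<le> word_scale 1 w powr t * word_scale (Suc k) v powr t"
      using assms(1) by (metis less_imp_le powr_mono2 powr_mult)
  qed
  also have "word_scale 1 w powr t * T \<le> word_scale 1 w powr t * (C powr t * level_sum t n)"
  proof (rule mult_left_mono)
    have "T \<le> level_sum t k * T"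
      using assms(3) T0 by (simp add: mult_le_cancel_right1)
    also have "\<dots> = (\<Sum>u\<in>words I 1 k. \<Sum>v\<in>words I (Suc k) n. word_scale 1 u powr t * word_scale (Suc k) v powr t)"
      unfolding level_sum_def T_def by (simp add: sum_product)
    also have "\<dots> \<le> (\<Sum>u\<in>words I 1 k. \<Sum>v\<in>words I (Suc k) n. C powr t * word_scale 1 (u @ v) powr t)"
    proof (intro sum_mono)
      fix u v assume uv: "u \<in> words I 1 k" "v \<in> words I (Suc k) n"
      then have "level_word 1 (u @ v)" "1 + length u = Suc k"
        by (auto simp: words_iff)
      then have "word_scale 1 u * word_scale (Suc k) v \<le> C * word_scale 1 (u @ v)" "0 < word_scale 1 (u @ v)"
          "0 < word_scale 1 u" "0 < word_scale (Suc k) v"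
        using scale_append_ge[of 1 u v] scale_pos[of 1] scale_pos[of "Suc k" v] by auto
      then show "word_scale 1 u powr t * word_scale (Suc k) v powr t \<le> C powr t * word_scale 1 (u @ v) powr t"
        using assms(1) C powr_mono2[of t "word_scale 1 u * word_scale (Suc k) v" "C * word_scale 1 (u @ v)"]
        by (simp add: powr_mult)
    qed
    also have "\<dots> = C powr t * level_sum t n"
      unfolding level_sum_def sum_words_split[OF assms(2)] by (simp add: sum_distrib_left)
    finally show "T \<le> C powr t * level_sum t n" .
  qed simp
  finally show ?thesis
    by (simp add: mult_ac)
qed

section \<open>The upper bound\<close>

lemma lower_pressure_eq:
  "lower_pressure I \<phi> J t = liminf (\<lambda>k. ereal (1 / real k * ln (level_sum t k)))"
  by (simp add: lower_pressure_def level_sum_def)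

lemma eventually_word_scale_le:
  assumes "0 < e"
  shows "eventually (\<lambda>k. \<forall>u\<in>words I 1 k. word_scale 1 u \<le> e) sequentially"
proof -
  have "eventually (\<lambda>k. C * exp (ln c * real k) \<le> e) sequentially"
    using c assms by (intro eventually_exp_decay_le) auto
  then show ?thesis
  proof eventually_elim
    case (elim k)
    have "c ^ k = exp (ln c * real k)"
      using c by (simp add: exp_of_nat2_mult)
    then show ?case
      using elim scale_le_power[of 1] by (fastforce simp: words_iff)
  qed
qed

text \<open>
  For \<open>t \<le> 0\<close> every word of scale at most \<open>1\<close> contributes at least \<open>1\<close> to the level sum.
\<close>

lemma pressure_neg_imp_pos:
  assumes "lower_pressure I \<phi> J t < 0"
  shows "0 < t"
proof (rule ccontr)
  assume "\<not> 0 < t"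
  have "eventually (\<lambda>k. \<forall>u\<in>words I 1 k. word_scale 1 u \<le> 1) sequentially"
    by (rule eventually_word_scale_le) simp
  then have "eventually (\<lambda>k. 0 \<le> ereal (1 / real k * ln (level_sum t k))) sequentially"
  proof eventually_elim
    case (elim k)
    obtain u where u: "u \<in> words I 1 k"
      using words_nonempty by blast
    have "word_scale 1 u powr 0 \<le> word_scale 1 u powr t"
      using elim u scale_pos[of 1 u] \<open>\<not> 0 < t\<close> by (intro powr_mono') (auto simp: words_iff)
    then have "1 \<le> word_scale 1 u powr t"
      using scale_pos[of 1 u] u by (simp add: words_iff)
    also have "\<dots> \<le> level_sum t k"
      unfolding level_sum_def by (rule member_le_sum[OF u]) (auto simp: finite_words)
    finally show ?case
      by simp
  qed
  then have "0 \<le> lower_pressure I \<phi> J t"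
    unfolding lower_pressure_eq by (rule Liminf_bounded)
  then show False
    using assms by simp
qed

lemma attractor_subset_level: "1 \<le> k \<Longrightarrow> attractor I Jw \<subseteq> (\<Union>u\<in>words I 1 k. Jw u)"
  unfolding attractor_def by blast

lemma hausdorff_measure_attractor_zero:
  assumes "lower_pressure I \<phi> J t < 0"
  shows "hausdorff_measure t (attractor I Jw) = 0"
proof -
  have "0 < t"
    using pressure_neg_imp_pos[OF assms] .
  obtain A where A: "0 < A"
    and diam: "\<And>u x y. level_word 1 u \<Longrightarrow> x \<in> Jw u \<Longrightarrow> y \<in> Jw u \<Longrightarrow> dist x y \<le> A * word_scale 1 u"
    using Jw_diameter by blast
  have "\<not> 0 \<le> liminf (\<lambda>k. ereal (1 / real k * ln (level_sum t k)))"
    using assms unfolding lower_pressure_eq by simp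
  then obtain y where y: "y < 0" "\<not> eventually (\<lambda>k. y < ereal (1 / real k * ln (level_sum t k))) sequentially"
    unfolding le_Liminf_iff by blast
  obtain r where r: "y < ereal r" "ereal r < 0"
    using ereal_dense2[OF y(1)] by blast
  \<comment> \<open>A negative lower limit yields a negative rate that is undercut infinitely often.\<close>
  have freq: "frequently (\<lambda>k. 1 / real k * ln (level_sum t k) < r) sequentially"
    unfolding frequently_def
  proof
    assume "eventually (\<lambda>k. \<not> 1 / real k * ln (level_sum t k) < r) sequentially"
    then have "eventually (\<lambda>k. y < ereal (1 / real k * ln (level_sum t k))) sequentially"
      by (rule eventually_mono) (use r(1) in \<open>auto intro: less_le_trans\<close>)
    then show False
      using y(2) by blast
  qed
  have small: "hausdorff_premeasure t \<delta> (attractor I Jw) \<le> ennreal e" if "0 < \<delta>" "0 < e" for \<delta> e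
  proof -
    have "eventually (\<lambda>k. (\<forall>u\<in>words I 1 k. word_scale 1 u \<le> \<delta> / A)
        \<and> A powr t * exp (r * real k) \<le> e \<and> 1 \<le> k) sequentially"
      using that A r(2)
      by (intro eventually_conj eventually_word_scale_le eventually_exp_decay_le eventually_ge_at_top) auto
    then obtain k where k: "1 / real k * ln (level_sum t k) < r" "1 \<le> k"
        "\<And>u. u \<in> words I 1 k \<Longrightarrow> word_scale 1 u \<le> \<delta> / A" "A powr t * exp (r * real k) \<le> e"
      using frequently_ex[OF frequently_eventually_conj[OF freq]] by blast
    have "ln (level_sum t k) < r * real k"
      using k(1,2) by (simp add: divide_less_eq)
    then have S: "level_sum t k < exp (r * real k)"
      using level_sum_pos[of t k] by (metis exp_less_mono exp_ln)
    have "hausdorff_premeasure t \<delta> (attractor I Jw) \<le> ennreal (\<Sum>u\<in>words I 1 k. (A * word_scale 1 u) powr t)"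
    proof (rule hausdorff_premeasure_le_finite_cover)
      fix u assume u: "u \<in> words I 1 k"
      then have lu: "level_word 1 u"
        by (simp add: words_iff)
      have "diameter (Jw u) \<le> A * word_scale 1 u"
        using Jw_nonempty[OF lu] diam[OF lu] by (intro diameter_le) (auto simp: dist_norm)
      then show "bounded (Jw u) \<and> diameter (Jw u) \<le> A * word_scale 1 u \<and> A * word_scale 1 u \<le> \<delta>"
        using Jw_compact[OF lu] k(3)[OF u] A by (auto simp: compact_imp_bounded field_simps)
    qed (use \<open>0 < t\<close> \<open>0 < \<delta>\<close> finite_words attractor_subset_level[OF k(2)] in auto)
    also have "(\<Sum>u\<in>words I 1 k. (A * word_scale 1 u) powr t) = A powr t * level_sum t k"
      unfolding level_sum_def sum_distrib_left using A scale_pos[of 1]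
      by (intro sum.cong) (auto simp: words_iff powr_mult less_imp_le)
    also have "\<dots> \<le> A powr t * exp (r * real k)"
      using S by (intro mult_left_mono) auto
    finally show ?thesis
      using k(4) by (meson dual_order.trans ennreal_leI)
  qed
  have "hausdorff_premeasure t \<delta> (attractor I Jw) = 0" if "0 < \<delta>" for \<delta>
  proof -
    have "hausdorff_premeasure t \<delta> (attractor I Jw) \<le> 0"
      by (rule ennreal_le_epsilon) (use small[OF that] in auto)
    then show ?thesis
      by simp
  qed
  then show ?thesis
    unfolding hausdorff_measure_def by (auto simp: SUP_eq_const)
qed

section \<open>Stopping words\<close>

definition stopping_words :: "real \<Rightarrow> 'i list set" where
  "stopping_words r =
     {w. level_word 1 w \<and> word_scale 1 w \<le> r \<and> (\<forall>j<length w. r < word_scale 1 (take j w))}"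

lemma level_word_take: "level_word l u \<Longrightarrow> level_word l (take j u)"
  by (simp add: level_word_def)

lemma stopping_word_prefix_scale:
  assumes "w \<in> stopping_words r" "w = v @ x" "x \<noteq> []"
  shows "r < word_scale 1 v"
proof -
  have "\<forall>j<length w. r < word_scale 1 (take j w)"
    using assms(1) unfolding stopping_words_def by blast
  then have "r < word_scale 1 (take (length v) w)"
    using assms(2,3) by (metis length_append less_add_same_cancel1 length_greater_0_conv)
  then show ?thesis
    using assms(2) by simp
qed

lemma stopping_words_parallel:
  assumes "v \<in> stopping_words r" "w \<in> stopping_words r" "v \<noteq> w"
  shows "v \<parallel> w"
proof -
  have no_prefix: "\<not> prefix v w" if "v \<in> stopping_words r" "w \<in> stopping_words r" "v \<noteq> w" for v w
  proof
    assume "prefix v w"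
    then obtain x where x: "w = v @ x"
      by (rule prefixE)
    then have "r < word_scale 1 v"
      using that(3) by (intro stopping_word_prefix_scale[OF that(2)]) auto
    then show False
      using that(1) unfolding stopping_words_def by simp
  qed
  show ?thesis
    using no_prefix[of v w] no_prefix[of w v] assms by (simp add: parallel_def)
qed

lemma stopping_prefix_exists:
  assumes "level_word 1 u" "word_scale 1 u \<le> r"
  obtains j where "j \<le> length u" "take j u \<in> stopping_words r"
proof -
  define j where "j = (LEAST j. word_scale 1 (take j u) \<le> r)"
  have len: "word_scale 1 (take (length u) u) \<le> r"
    using assms by simp
  have "word_scale 1 (take j u) \<le> r"
    unfolding j_def using len by (rule LeastI)
  moreover have jle: "j \<le> length u"
    unfolding j_def using len by (rule Least_le)
  moreover have "r < word_scale 1 (take i u)" if "i < j" for i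
    using not_less_Least[of i "\<lambda>j. word_scale 1 (take j u) \<le> r"] that by (simp add: j_def)
  ultimately have "take j u \<in> stopping_words r"
    using assms level_word_take unfolding stopping_words_def by auto
  then show thesis
    using jle that by blast
qed

text \<open>
  There are only finitely many words of length below \<open>N\<close>. This turns asymptotic information on
  levels into information on small radii.
\<close>

lemma small_words_are_long:
  obtains r where "0 < r" and "\<And>w. level_word 1 w \<Longrightarrow> word_scale 1 w \<le> r \<Longrightarrow> N \<le> length w"
proof -
  let ?S = "\<Union>k<N. words I 1 k"
  have fin: "finite (insert 1 (word_scale 1 ` ?S))"
    using finite_words by simp
  define r where "r = Min (insert 1 (word_scale 1 ` ?S)) / 2"
  have "0 < Min (insert 1 (word_scale 1 ` ?S))"
    using fin scale_pos[of 1] by (subst Min_gr_iff) (auto simp: words_iff)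
  then have r: "0 < r"
    by (simp add: r_def)
  moreover have "N \<le> length w" if w: "level_word 1 w" "word_scale 1 w \<le> r" for w
  proof (rule ccontr)
    assume "\<not> N \<le> length w"
    then have "w \<in> ?S"
      using level_word_words[OF w(1)] by auto
    then have "Min (insert 1 (word_scale 1 ` ?S)) \<le> word_scale 1 w"
      using fin by (intro Min_le) auto
    then show False
      using w(2) r by (simp add: r_def)
  qed
  ultimately show thesis
    using that by blast
qed

section \<open>Counting stopping words near a ball\<close>

lemma min_scale_pos_le:
  assumes "1 \<le> k"
  shows "0 < min_scale I \<phi> J k" and "i \<in> I k \<Longrightarrow> min_scale I \<phi> J k \<le> word_scale k [i]"
proof -
  have eq: "word_scale k [i] = deriv_sup J (\<phi> k i)" for i
    by simp
  have fin: "finite ((\<lambda>i. deriv_sup J (\<phi> k i)) ` I k)" and ne: "(\<lambda>i. deriv_sup J (\<phi> k i)) ` I k \<noteq> {}"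
    using index_sets I_nonempty assms by auto
  have "min_scale I \<phi> J k \<in> (\<lambda>i. deriv_sup J (\<phi> k i)) ` I k"
    unfolding min_scale_def using cInf_eq_Min[OF fin ne] Min_in[OF fin ne] by simp
  then obtain i' where i': "i' \<in> I k" "min_scale I \<phi> J k = deriv_sup J (\<phi> k i')"
    by blast
  then show "0 < min_scale I \<phi> J k"
    using scale_pos[of k "[i']"] assms eq[of i'] by simp
  show "min_scale I \<phi> J k \<le> word_scale k [i]" if "i \<in> I k"
    unfolding eq min_scale_def using fin that by (intro cINF_lower bdd_below_finite)
qed

lemma word_scale_le_max_scale: "w \<in> words I 1 k \<Longrightarrow> word_scale 1 w \<le> max_scale I \<phi> J k"
  unfolding max_scale_def using finite_words[of 1 k] by (intro cSUP_upper bdd_above_finite) auto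

text \<open>
  The form in which the hypothesis on \<open>ln (min_scale) / ln (max_scale)\<close> enters. On deep levels the logarithm of
  the maximal scale is negative, so a ratio below \<open>e\<close> means that the minimal scale exceeds the \<open>e\<close>-th power of
  the maximal one.
\<close>

lemma eventually_min_scale_ge:
  assumes "(\<lambda>k. ln (min_scale I \<phi> J k) / ln (max_scale I \<phi> J k)) \<longlonglongrightarrow> 0" and "0 < e"
  shows "eventually (\<lambda>k. \<forall>w\<in>words I 1 k. word_scale 1 w powr e \<le> min_scale I \<phi> J k) sequentially"
proof -
  have "eventually (\<lambda>k. ln (min_scale I \<phi> J k) / ln (max_scale I \<phi> J k) < e) sequentially"
    using assms by (intro order_tendstoD)
  moreover have "eventually (\<lambda>k. \<forall>w\<in>words I 1 k. word_scale 1 w \<le> 1/2) sequentially"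
    by (rule eventually_word_scale_le) simp
  moreover have "eventually (\<lambda>k. 1 \<le> k) sequentially"
    by (rule eventually_ge_at_top)
  ultimately show ?thesis
  proof eventually_elim
    case (elim k)
    obtain u where u: "u \<in> words I 1 k"
      using words_nonempty by blast
    have "max_scale I \<phi> J k \<le> 1/2"
      unfolding max_scale_def using elim(2) words_nonempty by (intro cSUP_least) auto
    moreover have max_pos: "0 < max_scale I \<phi> J k"
      using word_scale_le_max_scale[OF u] scale_pos[of 1 u] u by (simp add: words_iff)
    ultimately have "ln (max_scale I \<phi> J k) < 0"
      by simp
    then have "e * ln (max_scale I \<phi> J k) < ln (min_scale I \<phi> J k)"
      using elim(1) by (simp add: neg_divide_less_eq)
    then have "exp (e * ln (max_scale I \<phi> J k)) \<le> min_scale I \<phi> J k"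
      using min_scale_pos_le(1)[OF elim(3)] by (metis exp_le_cancel_iff exp_ln less_imp_le)
    then have max_le: "max_scale I \<phi> J k powr e \<le> min_scale I \<phi> J k"
      using max_pos by (simp add: powr_def)
    show ?case
    proof
      fix w assume w: "w \<in> words I 1 k"
      have "word_scale 1 w powr e \<le> max_scale I \<phi> J k powr e"
        using scale_pos[of 1 w] w word_scale_le_max_scale[OF w] \<open>0 < e\<close>
        by (intro powr_mono2) (auto simp: words_iff)
      then show "word_scale 1 w powr e \<le> min_scale I \<phi> J k"
        using max_le by linarith
    qed
  qed
qed

text \<open>
  For \<open>w = v i\<close> the prefix \<open>v\<close> still has scale above \<open>r\<close>, and the letter \<open>i\<close> contributes at least
  \<open>|w|\<^sup>e\<close>. Hence \<open>C |w| \<ge> r |w|\<^sup>e\<close>, that is \<open>|w| \<ge> (r / C)\<^sup>p\<close> with \<open>p = 1 / (1 - e)\<close>.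
\<close>

lemma stopping_word_scale_ge:
  assumes lim: "(\<lambda>k. ln (min_scale I \<phi> J k) / ln (max_scale I \<phi> J k)) \<longlonglongrightarrow> 0" and "1 < p"
  obtains r0 where "0 < r0"
    and "\<And>r w. 0 < r \<Longrightarrow> r \<le> r0 \<Longrightarrow> w \<in> stopping_words r \<Longrightarrow> (r / C) powr p \<le> word_scale 1 w"
proof -
  define e where "e = 1 - 1 / p"
  have e: "0 < e"
    using \<open>1 < p\<close> by (simp add: e_def)
  obtain N where N: "\<And>k w. N \<le> k \<Longrightarrow> w \<in> words I 1 k \<Longrightarrow> word_scale 1 w powr e \<le> min_scale I \<phi> J k"
    using eventually_min_scale_ge[OF lim e] unfolding eventually_sequentially by blast
  obtain r0 where r0: "0 < r0" "\<And>w. level_word 1 w \<Longrightarrow> word_scale 1 w \<le> r0 \<Longrightarrow> Suc N \<le> length w"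
    using small_words_are_long by blast
  show thesis
  proof (rule that[OF r0(1)])
    fix r w assume r: "0 < r" "r \<le> r0" and w: "w \<in> stopping_words r"
    then have lw: "level_word 1 w" "word_scale 1 w \<le> r"
      unfolding stopping_words_def by auto
    then have len: "Suc N \<le> length w"
      using r0(2) r(2) by auto
    then obtain v i where vi: "w = v @ [i]"
      by (cases w rule: rev_cases) auto
    have wpos: "0 < word_scale 1 w"
      using scale_pos[of 1 w] lw by simp
    have "r < word_scale 1 v"
      by (rule stopping_word_prefix_scale[OF w vi]) simp
    moreover have "word_scale 1 w powr e \<le> word_scale (1 + length v) [i]"
    proof -
      have "word_scale 1 w powr e \<le> min_scale I \<phi> J (length w)"
        using N level_word_words[OF lw(1)] len by auto
      also have "\<dots> \<le> word_scale (length w) [i]"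
        using lw(1) vi by (intro min_scale_pos_le(2)) auto
      finally show ?thesis
        using vi by simp
    qed
    ultimately have "r * word_scale 1 w powr e \<le> word_scale 1 v * word_scale (1 + length v) [i]"
      using r(1) by (intro mult_mono) auto
    also have "\<dots> \<le> C * word_scale 1 w"
      using scale_append_ge[of 1 v "[i]"] lw(1) vi by simp
    also have "\<dots> = C * word_scale 1 w powr (1 / p) * word_scale 1 w powr e"
      using wpos by (simp add: e_def mult.assoc flip: powr_add)
    finally have "r \<le> C * word_scale 1 w powr (1 / p)"
      using wpos by simp
    then have "r / C \<le> word_scale 1 w powr (1 / p)"
      using C by (simp add: pos_divide_le_eq mult.commute)
    then have "(r / C) powr p \<le> (word_scale 1 w powr (1 / p)) powr p"
      using r(1) C \<open>1 < p\<close> by (intro powr_mono2) auto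
    then show "(r / C) powr p \<le> word_scale 1 w"
      using wpos \<open>1 < p\<close> by (simp add: powr_powr)
  qed
qed

text \<open>
  Volume comparison: disjoint balls of radius of order \<open>r\<^sup>p\<close> lie in a ball of radius of order \<open>r\<close>, so
  there are at most a constant times \<open>r\<close> to the power \<open>(1 - p) d\<close> of them, where \<open>d\<close> is the dimension.
\<close>

lemma card_stopping_words_near_ball:
  assumes osc: "open_set_condition I Jw"
    and lim: "(\<lambda>k. ln (min_scale I \<phi> J k) / ln (max_scale I \<phi> J k)) \<longlonglongrightarrow> 0"
    and "0 < q"
  obtains B r0 where "0 < B" "0 < r0"
    and "\<And>x r W. 0 < r \<Longrightarrow> r \<le> r0 \<Longrightarrow> finite W \<Longrightarrow> W \<subseteq> stopping_words r \<Longrightarrow>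
      (\<forall>w\<in>W. Jw w \<inter> ball x r \<noteq> {}) \<Longrightarrow> real (card W) \<le> B * r powr (- q)"
proof -
  let ?d = "DIM('a)"
  \<comment> \<open>Chosen so that \<open>(1 - p) * d = - q\<close>.\<close>
  define p where "p = 1 + q / ?d"
  have p: "1 < p"
    using \<open>0 < q\<close> by (simp add: p_def)
  obtain r0 where r0: "0 < r0"
    and low: "\<And>r w. 0 < r \<Longrightarrow> r \<le> r0 \<Longrightarrow> w \<in> stopping_words r \<Longrightarrow> (r / C) powr p \<le> word_scale 1 w"
    using stopping_word_scale_ge[OF lim p] by blast
  obtain A where A: "0 < A"
    and diam: "\<And>u x y. level_word 1 u \<Longrightarrow> x \<in> Jw u \<Longrightarrow> y \<in> Jw u \<Longrightarrow> dist x y \<le> A * word_scale 1 u"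
    using Jw_diameter by blast
  obtain a where a: "0 < a" and inball: "\<And>u. level_word 1 u \<Longrightarrow> \<exists>z. ball z (a * word_scale 1 u) \<subseteq> Jw u"
    using Jw_contains_ball by blast
  obtain z where z: "\<And>u. level_word 1 u \<Longrightarrow> ball (z u) (a * word_scale 1 u) \<subseteq> Jw u"
    using inball by metis
  define D where "D = (1 + A) * C powr p / a"
  have D: "0 < D"
    using A C a by (simp add: D_def)
  show thesis
  proof (rule that[of "D ^ ?d" r0])
    fix x r W
    assume r: "0 < r" "r \<le> r0" and W: "finite W" "W \<subseteq> stopping_words r"
      and near: "\<forall>w\<in>W. Jw w \<inter> ball x r \<noteq> {}"
    define \<rho> where "\<rho> = a * (r / C) powr p"
    have \<rho>: "0 < \<rho>"
      using a r C by (simp add: \<rho>_def)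
    have stop: "level_word 1 w" "word_scale 1 w \<le> r" "(r / C) powr p \<le> word_scale 1 w" if "w \<in> W" for w
      using that W low[OF r] unfolding stopping_words_def by auto
    have ball_Jw: "ball (z w) \<rho> \<subseteq> Jw w" if "w \<in> W" for w
    proof -
      have "ball (z w) \<rho> \<subseteq> ball (z w) (a * word_scale 1 w)"
        using stop(3)[OF that] a by (intro subset_ball) (simp add: \<rho>_def)
      then show ?thesis
        using z[OF stop(1)[OF that]] by blast
    qed
    have Jw_ball: "Jw w \<subseteq> ball x ((1 + A) * r)" if "w \<in> W" for w
    proof
      fix y' assume y': "y' \<in> Jw w"
      obtain y where y: "y \<in> Jw w" "dist x y < r"
        using near \<open>w \<in> W\<close> by force
      have "dist y y' \<le> A * word_scale 1 w"
        using diam[OF stop(1)[OF that] y(1) y'] .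
      also have "\<dots> \<le> A * r"
        using A stop(2)[OF that] by simp
      finally show "y' \<in> ball x ((1 + A) * r)"
        using y(2) dist_triangle[of x y' y] by (simp add: algebra_simps)
    qed
    have "real (card W) * \<rho> ^ ?d \<le> ((1 + A) * r) ^ ?d"
    proof (rule card_disjoint_balls_le[OF W(1) \<rho>])
      show "0 \<le> (1 + A) * r"
        using A r by simp
      show "ball (z w) \<rho> \<subseteq> ball x ((1 + A) * r)" if "w \<in> W" for w
        using ball_Jw[OF that] Jw_ball[OF that] by blast
      fix v w assume vw: "v \<in> W" "w \<in> W" "v \<noteq> w"
      then have "interior (Jw v) \<inter> interior (Jw w) = {}"
        using W(2) by (intro interior_Jw_disjoint[OF osc] stop stopping_words_parallel[of _ r]) auto
      moreover have "ball (z v) \<rho> \<subseteq> interior (Jw v)" "ball (z w) \<rho> \<subseteq> interior (Jw w)"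
        using ball_Jw vw by (auto intro: interior_maximal[THEN subsetD])
      ultimately show "ball (z v) \<rho> \<inter> ball (z w) \<rho> = {}"
        by blast
    qed
    also have "(1 + A) * r = D * r powr (1 - p) * \<rho>"
    proof -
      have "r powr (1 - p) * r powr p = r"
        using r by (simp flip: powr_add)
      then show ?thesis
        using a r C by (simp add: D_def \<rho>_def powr_divide)
    qed
    finally have "real (card W) \<le> (D * r powr (1 - p)) ^ ?d"
      using \<rho> by (simp add: power_mult_distrib)
    also have "\<dots> = D ^ ?d * r powr ((1 - p) * ?d)"
      using r by (simp add: power_mult_distrib powr_powr flip: powr_realpow)
    also have "(1 - p) * ?d = - q"
      by (simp add: p_def)
    finally show "real (card W) \<le> D ^ ?d * r powr (- q)" .
  qed (use D r0 in auto)
qed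

section \<open>The lower bound\<close>

text \<open>
  The Frostman-type estimate: few stopping words, each of mass at most a constant times \<open>r\<^sup>t\<close>. Only
  small radii are admitted, so that the stopping words are long enough for the level sums of their
  lengths to be at least \<open>1\<close>.
\<close>

lemma ball_mass_le:
  assumes osc: "open_set_condition I Jw"
    and lim: "(\<lambda>k. ln (min_scale I \<phi> J k) / ln (max_scale I \<phi> J k)) \<longlonglongrightarrow> 0"
    and st: "0 \<le> s" "s < t"
    and ev: "eventually (\<lambda>k. 1 \<le> level_sum t k) sequentially"
  obtains B r0 where "0 < B" "0 < r0"
    and "\<And>x r n. 0 < r \<Longrightarrow> r \<le> r0 \<Longrightarrow> (\<forall>u\<in>words I 1 n. word_scale 1 u \<le> r) \<Longrightarrow>
      (\<Sum>u\<in>{u\<in>words I 1 n. Jw u \<inter> ball x r \<noteq> {}}. word_scale 1 u powr t) \<le> B * r powr s * level_sum t n"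
proof -
  obtain K where K: "\<And>k. K \<le> k \<Longrightarrow> 1 \<le> level_sum t k"
    using ev unfolding eventually_sequentially by blast
  obtain r1 where r1: "0 < r1" "\<And>w. level_word 1 w \<Longrightarrow> word_scale 1 w \<le> r1 \<Longrightarrow> K \<le> length w"
    using small_words_are_long by blast
  have gap: "0 < t - s"
    using st by simp
  obtain B r2 where B: "0 < B" "0 < r2"
    and card: "\<And>x r W. 0 < r \<Longrightarrow> r \<le> r2 \<Longrightarrow> finite W \<Longrightarrow> W \<subseteq> stopping_words r \<Longrightarrow>
      (\<forall>w\<in>W. Jw w \<inter> ball x r \<noteq> {}) \<Longrightarrow> real (card W) \<le> B * r powr (- (t - s))"
    using card_stopping_words_near_ball[OF osc lim gap] by blast
  show thesis
  proof (rule that[of "B * C powr t" "min r1 r2"])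
    show "0 < B * C powr t" "0 < min r1 r2"
      using B C r1 by auto
    fix x r n
    assume r: "0 < r" "r \<le> min r1 r2" and n: "\<forall>u\<in>words I 1 n. word_scale 1 u \<le> r"
    define W where "W = {w\<in>stopping_words r. length w \<le> n \<and> Jw w \<inter> ball x r \<noteq> {}}"
    let ?P = "SIGMA w:W. words I (Suc (length w)) n"
    have "W \<subseteq> (\<Union>k\<le>n. words I 1 k)"
      unfolding W_def stopping_words_def by (auto simp: words_iff)
    then have finW: "finite W"
      by (rule finite_subset) (simp add: finite_words)
    have finP: "finite ?P"
      using finW finite_words by auto
    have "{u\<in>words I 1 n. Jw u \<inter> ball x r \<noteq> {}} \<subseteq> (\<lambda>(w, v). w @ v) ` ?P"
    proof
      fix u assume "u \<in> {u\<in>words I 1 n. Jw u \<inter> ball x r \<noteq> {}}"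
      then have u: "u \<in> words I 1 n" "Jw u \<inter> ball x r \<noteq> {}"
        by auto
      then have lu: "level_word 1 u" "length u = n"
        by (auto simp: words_iff)
      obtain j where j: "j \<le> length u" "take j u \<in> stopping_words r"
        using stopping_prefix_exists[OF lu(1)] n u(1) by blast
      have split: "level_word 1 (take j u @ drop j u)"
        using lu(1) by simp
      have "Jw u \<subseteq> Jw (take j u)"
        using Jw_append_subset[OF split] by simp
      then have "take j u \<in> W"
        unfolding W_def using j u(2) lu(2) by auto
      moreover have "drop j u \<in> words I (Suc (length (take j u))) n"
        using split j(1) lu(2) unfolding level_word_append by (simp add: words_iff)
      ultimately have "(take j u, drop j u) \<in> ?P"
        by blast
      then show "u \<in> (\<lambda>(w, v). w @ v) ` ?P"
        by (rule rev_image_eqI) simp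
    qed
    then have "(\<Sum>u\<in>{u\<in>words I 1 n. Jw u \<inter> ball x r \<noteq> {}}. word_scale 1 u powr t)
        \<le> (\<Sum>u\<in>(\<lambda>(w, v). w @ v) ` ?P. word_scale 1 u powr t)"
      using finP by (intro sum_mono2) auto
    also have "\<dots> \<le> (\<Sum>(w, v)\<in>?P. word_scale 1 (w @ v) powr t)"
      using sum_image_le[OF finP, of "\<lambda>u. word_scale 1 u powr t" "\<lambda>(w, v). w @ v"]
      by (simp add: case_prod_unfold comp_def)
    also have "\<dots> = (\<Sum>w\<in>W. \<Sum>v\<in>words I (Suc (length w)) n. word_scale 1 (w @ v) powr t)"
      using finW finite_words by (subst sum.Sigma) auto
    also have "\<dots> \<le> real (card W) * (C powr t * r powr t * level_sum t n)"
    proof (rule sum_bounded_above)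
      fix w assume "w \<in> W"
      then have w: "level_word 1 w" "word_scale 1 w \<le> r" "length w \<le> n"
        unfolding W_def stopping_words_def by auto
      then have "K \<le> length w"
        using r1(2) r(2) by auto
      then have "(\<Sum>v\<in>words I (Suc (length w)) n. word_scale 1 (w @ v) powr t)
          \<le> C powr t * word_scale 1 w powr t * level_sum t n"
        using st w level_word_words[OF w(1)] by (intro sum_descendants_le K) auto
      also have "\<dots> \<le> C powr t * r powr t * level_sum t n"
        using st w scale_pos[of 1 w] level_sum_pos[of t n]
        by (intro mult_right_mono mult_left_mono powr_mono2) auto
      finally show "(\<Sum>v\<in>words I (Suc (length w)) n. word_scale 1 (w @ v) powr t)
          \<le> C powr t * r powr t * level_sum t n" .
    qed
    also have "\<dots> \<le> B * r powr (- (t - s)) * (C powr t * r powr t * level_sum t n)"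
    proof (rule mult_right_mono)
      show "real (card W) \<le> B * r powr (- (t - s))"
        by (rule card[OF r(1) _ finW, of x]) (use r(2) in \<open>auto simp: W_def\<close>)
      show "0 \<le> C powr t * r powr t * level_sum t n"
        using level_sum_pos[of t n] by simp
    qed
    also have "\<dots> = B * C powr t * (r powr (- (t - s)) * r powr t) * level_sum t n"
      by (simp add: mult_ac)
    also have "r powr (- (t - s)) * r powr t = r powr s"
      by (simp flip: powr_add)
    finally show "(\<Sum>u\<in>{u\<in>words I 1 n. Jw u \<inter> ball x r \<noteq> {}}. word_scale 1 u powr t)
        \<le> B * C powr t * r powr s * level_sum t n" .
  qed
qed

text \<open>
  The unions of the basic sets of each level are compact and decrease to the attractor, so one of them
  is contained in any given open neighbourhood of it.
\<close>

lemma open_cover_attractor_covers_level: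
  assumes "attractor I Jw \<subseteq> (\<Union>i\<in>N. G i)" "\<And>i. i \<in> N \<Longrightarrow> open (G i)"
  obtains F where "F \<subseteq> N" "finite F"
    and "eventually (\<lambda>n. \<forall>u\<in>words I 1 n. Jw u \<subseteq> (\<Union>i\<in>F. G i)) sequentially"
proof -
  define X where "X k = (\<Union>u\<in>words I 1 (Suc k). Jw u)" for k
  have compX: "compact (X k)" for k
    unfolding X_def using finite_words by (intro compact_UN Jw_compact) (auto simp: words_iff)
  have stepX: "X (Suc k) \<subseteq> X k" for k
    unfolding X_def
  proof
    fix y assume "y \<in> (\<Union>u\<in>words I 1 (Suc (Suc k)). Jw u)"
    then obtain u where u: "u \<in> words I 1 (Suc (Suc k))" "y \<in> Jw u"
      by blast
    then obtain v i where v: "u = v @ [i]"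
      by (cases u rule: rev_cases) (auto simp: words_iff)
    then have "Jw u \<subseteq> Jw v" "v \<in> words I 1 (Suc k)"
      using u(1) Jw_append_subset[of v "[i]"] by (auto simp: words_iff)
    then show "y \<in> (\<Union>u\<in>words I 1 (Suc k). Jw u)"
      using u(2) by blast
  qed
  have decX: "X n \<subseteq> X m" if "m \<le> n" for m n
    using lift_Suc_antimono_le[of X, OF stepX that] .
  have E: "attractor I Jw = (\<Inter>k. X k)"
  proof -
    have "{1..} = range Suc"
      by (auto simp: image_iff Bex_def dest: Suc_le_D)
    then show ?thesis
      unfolding attractor_def X_def by simp
  qed
  have "compact (attractor I Jw)"
    unfolding E by (rule compact_Inter) (use compX in auto)
  from compactE_image[OF this assms(2,1)]
  obtain F where F: "F \<subseteq> N" "finite F" "attractor I Jw \<subseteq> (\<Union>i\<in>F. G i)"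
    by blast
  let ?O = "\<Union>i\<in>F. G i"
  have "open ?O"
    using F(1) assms(2) by blast
  have "\<exists>k. X k - ?O = {}"
  proof (rule ccontr)
    assume "\<nexists>k. X k - ?O = {}"
    then have "\<Inter>(range (\<lambda>k. X k - ?O)) \<noteq> {}"
    proof (intro compact_nest)
      show "compact (X j - ?O)" for j
        using compX \<open>open ?O\<close> by (rule compact_diff)
      show "X n - ?O \<subseteq> X m - ?O" if "m \<le> n" for m n
        using decX[OF that] by blast
    qed auto
    then show False
      using F(3) E by auto
  qed
  then obtain k where k: "X k \<subseteq> ?O"
    by blast
  have "\<forall>u\<in>words I 1 n. Jw u \<subseteq> ?O" if le: "Suc k \<le> n" for n
  proof -
    obtain m where "n = Suc m" "k \<le> m"
      using le by (cases n) auto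
    then show ?thesis
      using decX[of k m] k unfolding X_def by blast
  qed
  then have "eventually (\<lambda>n. \<forall>u\<in>words I 1 n. Jw u \<subseteq> ?O) sequentially"
    unfolding eventually_sequentially by blast
  then show thesis
    using that F by blast
qed

text \<open>
  The mass distribution principle at a finite level: a cover by small balls whose radii satisfy
  \<open>B * (\<Sum>i. r i powr s) < 1\<close> cannot catch all words of a deep level.
\<close>

lemma hausdorff_measure_attractor_nonzero:
  assumes osc: "open_set_condition I Jw"
    and lim: "(\<lambda>k. ln (min_scale I \<phi> J k) / ln (max_scale I \<phi> J k)) \<longlonglongrightarrow> 0"
    and st: "0 \<le> s" "s < t"
    and ev: "eventually (\<lambda>k. 1 \<le> level_sum t k) sequentially"
  shows "hausdorff_measure s (attractor I Jw) \<noteq> 0"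
proof
  assume zero: "hausdorff_measure s (attractor I Jw) = 0"
  let ?E = "attractor I Jw"
  obtain B r0 where B: "0 < B" "0 < r0"
    and mass: "\<And>x r n. 0 < r \<Longrightarrow> r \<le> r0 \<Longrightarrow> (\<forall>u\<in>words I 1 n. word_scale 1 u \<le> r) \<Longrightarrow>
      (\<Sum>u\<in>{u\<in>words I 1 n. Jw u \<inter> ball x r \<noteq> {}}. word_scale 1 u powr t) \<le> B * r powr s * level_sum t n"
    using ball_mass_le[OF osc lim st ev] by blast
  \<comment> \<open>The cover costs \<open>\<eta>\<close> and its enlargement to balls another \<open>\<eta>\<close>, while \<open>B * (2 * \<eta>) = 1 / 2\<close>.\<close>
  define \<eta> where "\<eta> = 1 / (4 * B)"
  have \<eta>: "0 < \<eta>"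
    using B by (simp add: \<eta>_def)
  have "hausdorff_premeasure s (r0 / 2) ?E \<le> hausdorff_measure s ?E"
    unfolding hausdorff_measure_def using B by (intro SUP_upper) auto
  then have "hausdorff_premeasure s (r0 / 2) ?E < ennreal \<eta>"
    using zero \<eta> by simp
  then obtain U :: "nat \<Rightarrow> 'a set" where U: "?E \<subseteq> (\<Union>n. U n)" "\<And>n. bounded (U n) \<and> diameter (U n) \<le> r0 / 2"
      "(\<Sum>n. diam_power s (U n)) < ennreal \<eta>"
    unfolding hausdorff_premeasure_def INF_less_iff by auto
  define N where "N = {n. U n \<noteq> {}}"
  have "\<forall>n\<in>N. \<exists>x r. U n \<subseteq> ball x r \<and> 0 < r \<and> r \<le> r0 \<and>
      ennreal (r powr s) \<le> diam_power s (U n) + ennreal (\<eta> * (1/2) ^ Suc n)"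
  proof
    fix n assume "n \<in> N"
    then obtain x where x: "x \<in> U n"
      unfolding N_def by blast
    have bd: "bounded (U n)" and "diameter (U n) < r0"
      using U(2)[of n] B(2) by auto
    then obtain r where r: "diameter (U n) < r" "r < r0"
        "ennreal (r powr s) \<le> diam_power s (U n) + ennreal (\<eta> * (1/2) ^ Suc n)"
      using diam_power_enlarge[OF st(1), of "U n" r0 "\<eta> * (1/2) ^ Suc n"] x \<eta> by auto
    have "U n \<subseteq> ball x r"
      using diameter_bounded_bound[OF bd x] r(1) by force
    moreover have "0 < r"
      using diameter_ge_0[OF bd] r(1) by linarith
    ultimately show "\<exists>x r. U n \<subseteq> ball x r \<and> 0 < r \<and> r \<le> r0 \<and>
        ennreal (r powr s) \<le> diam_power s (U n) + ennreal (\<eta> * (1/2) ^ Suc n)"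
      using r(2,3) by (intro exI[of _ x] exI[of _ r]) simp
  qed
  then obtain x r where xr: "\<And>n. n \<in> N \<Longrightarrow> U n \<subseteq> ball (x n) (r n) \<and> 0 < r n \<and> r n \<le> r0 \<and>
      ennreal (r n powr s) \<le> diam_power s (U n) + ennreal (\<eta> * (1/2) ^ Suc n)"
    by metis
  have "?E \<subseteq> (\<Union>n\<in>N. ball (x n) (r n))"
  proof
    fix y assume "y \<in> ?E"
    then obtain n where "y \<in> U n"
      using U(1) by blast
    moreover from this have "n \<in> N"
      unfolding N_def by blast
    ultimately show "y \<in> (\<Union>n\<in>N. ball (x n) (r n))"
      using xr by blast
  qed
  then obtain F where F: "F \<subseteq> N" "finite F"
    and cov: "eventually (\<lambda>n. \<forall>u\<in>words I 1 n. Jw u \<subseteq> (\<Union>i\<in>F. ball (x i) (r i))) sequentially"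
    by (rule open_cover_attractor_covers_level) auto
  have "eventually (\<lambda>n. \<forall>i\<in>F. \<forall>u\<in>words I 1 n. word_scale 1 u \<le> r i) sequentially"
    using F xr by (intro eventually_ball_finite ballI eventually_word_scale_le) auto
  from eventually_happens'[OF sequentially_bot eventually_conj[OF cov this]]
  obtain n where n: "\<forall>u\<in>words I 1 n. Jw u \<subseteq> (\<Union>i\<in>F. ball (x i) (r i))"
      "\<forall>i\<in>F. \<forall>u\<in>words I 1 n. word_scale 1 u \<le> r i"
    by (elim exE conjE)
  define M where "M i = {u\<in>words I 1 n. Jw u \<inter> ball (x i) (r i) \<noteq> {}}" for i
  have finM: "finite (M i)" for i
    unfolding M_def by (simp add: finite_words)
  have "words I 1 n \<subseteq> (\<Union>i\<in>F. M i)"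
  proof
    fix u assume u: "u \<in> words I 1 n"
    then obtain y where "y \<in> Jw u"
      using Jw_nonempty[of u] by (auto simp: words_iff)
    then show "u \<in> (\<Union>i\<in>F. M i)"
      using bspec[OF n(1) u] u unfolding M_def by blast
  qed
  then have "words I 1 n \<subseteq> snd ` (SIGMA i:F. M i)"
    by force
  then have "level_sum t n \<le> (\<Sum>u\<in>snd ` (SIGMA i:F. M i). word_scale 1 u powr t)"
    unfolding level_sum_def using F(2) finM by (intro sum_mono2) auto
  also have "\<dots> \<le> (\<Sum>(i, u)\<in>(SIGMA i:F. M i). word_scale 1 u powr t)"
    using sum_image_le[of "SIGMA i:F. M i" "\<lambda>u. word_scale 1 u powr t" snd] F(2) finM
    by (simp add: case_prod_unfold comp_def)
  also have "\<dots> = (\<Sum>i\<in>F. \<Sum>u\<in>M i. word_scale 1 u powr t)"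
    using F(2) finM by (subst sum.Sigma) auto
  also have "\<dots> \<le> (\<Sum>i\<in>F. B * r i powr s * level_sum t n)"
    unfolding M_def using F(1) xr n(2) by (intro sum_mono mass) auto
  also have "\<dots> = (B * (\<Sum>i\<in>F. r i powr s)) * level_sum t n"
    by (simp add: sum_distrib_left sum_distrib_right)
  finally have big: "1 \<le> B * (\<Sum>i\<in>F. r i powr s)"
    using level_sum_pos[of t n] by simp
  have "ennreal (\<Sum>i\<in>F. r i powr s) = (\<Sum>i\<in>F. ennreal (r i powr s))"
    by (simp add: sum_ennreal)
  also have "\<dots> \<le> (\<Sum>i\<in>F. diam_power s (U i) + ennreal (\<eta> * (1/2) ^ Suc i))"
    using F(1) xr by (intro sum_mono) auto
  also have "\<dots> = (\<Sum>i\<in>F. diam_power s (U i)) + ennreal (\<Sum>i\<in>F. \<eta> * (1/2) ^ Suc i)"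
    using \<eta> by (simp add: sum.distrib sum_ennreal)
  also have "\<dots> \<le> ennreal \<eta> + ennreal \<eta>"
  proof (rule add_mono)
    show "(\<Sum>i\<in>F. diam_power s (U i)) \<le> ennreal \<eta>"
      using sum_le_suminf[of "\<lambda>n. diam_power s (U n)" F] F(2) U(3) by simp
    have "(\<Sum>i\<in>F. (1/2::real) ^ Suc i) \<le> (\<Sum>i. (1/2) ^ Suc i)"
      using F(2) power_half_series by (intro sum_le_suminf) (auto simp: sums_iff)
    also have "\<dots> = 1"
      using power_half_series by (simp add: sums_iff)
    finally show "ennreal (\<Sum>i\<in>F. \<eta> * (1/2) ^ Suc i) \<le> ennreal \<eta>"
      unfolding sum_distrib_left[symmetric] using \<eta> by (intro ennreal_leI) (simp add: mult_left_le)
  qed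
  also have "\<dots> = ennreal (2 * \<eta>)"
    using \<eta> by (simp flip: ennreal_plus)
  finally have "(\<Sum>i\<in>F. r i powr s) \<le> 2 * \<eta>"
    using \<eta> by (simp add: ennreal_le_iff)
  then have "B * (\<Sum>i\<in>F. r i powr s) \<le> B * (2 * \<eta>)"
    using B by simp
  also have "\<dots> = 1 / 2"
    using B by (simp add: \<eta>_def)
  finally show False
    using big by simp
qed

section \<open>Pressure and the dimension formula\<close>

text \<open>
  Lowering the exponent by \<open>q\<close> multiplies every term by at least \<open>(C c\<^sup>k)\<^sup>-\<^sup>q\<close>, which grows exponentially,
  whereas \<open>S\<^sub>k(t')\<close> can only decay subexponentially.
\<close>

lemma eventually_level_sum_ge_1:
  assumes "0 \<le> lower_pressure I \<phi> J t'" "t < t'"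
  shows "eventually (\<lambda>k. 1 \<le> level_sum t k) sequentially"
proof -
  define q where "q = t' - t"
  \<comment> \<open>Half of the gained rate \<open>-b\<close> absorbs the subexponential decay, the other half the constant.\<close>
  define b where "b = q * ln c"
  have q: "0 < q" and b: "b < 0"
    using assms(2) c by (auto simp: q_def b_def mult_pos_neg)
  have "ereal (b / 2) < 0"
    using b by simp
  then have "eventually (\<lambda>k. ereal (b / 2) < ereal (1 / real k * ln (level_sum t' k))) sequentially"
    using assms(1) unfolding lower_pressure_eq le_Liminf_iff by blast
  moreover have "eventually (\<lambda>k. C powr q * exp (b / 2 * real k) \<le> 1) sequentially"
    using b by (intro eventually_exp_decay_le) auto
  moreover have "eventually (\<lambda>k. 1 \<le> k) sequentially"
    by (rule eventually_ge_at_top)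
  ultimately show ?thesis
  proof eventually_elim
    case (elim k)
    have "b / 2 * real k < ln (level_sum t' k)"
      using elim(1,3) by (simp add: less_divide_eq)
    then have "exp (b / 2 * real k) \<le> level_sum t' k"
      using level_sum_pos[of t' k] by (metis exp_less_mono exp_ln less_imp_le)
    also have "\<dots> \<le> (\<Sum>u\<in>words I 1 k. (C * c ^ k) powr q * word_scale 1 u powr t)"
      unfolding level_sum_def
    proof (rule sum_mono)
      fix u assume "u \<in> words I 1 k"
      then have u: "level_word 1 u" "length u = k"
        by (auto simp: words_iff)
      have "word_scale 1 u powr t' = word_scale 1 u powr q * word_scale 1 u powr t"
        by (simp add: q_def flip: powr_add)
      also have "\<dots> \<le> (C * c ^ k) powr q * word_scale 1 u powr t"
        using scale_pos[of 1 u] scale_le_power[of 1 u] u q by (intro mult_right_mono powr_mono2) auto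
      finally show "word_scale 1 u powr t' \<le> (C * c ^ k) powr q * word_scale 1 u powr t" .
    qed
    also have "\<dots> = (C * c ^ k) powr q * level_sum t k"
      unfolding level_sum_def by (simp add: sum_distrib_left)
    also have "(C * c ^ k) powr q = C powr q * exp (b / 2 * real k) * exp (b / 2 * real k)"
    proof -
      have "(c ^ k) powr q = exp (b * real k)"
        using c by (simp add: powr_def ln_realpow b_def mult_ac)
      then show ?thesis
        using C c by (simp add: powr_mult mult.assoc flip: exp_add)
    qed
    finally have "1 \<le> C powr q * exp (b / 2 * real k) * level_sum t k"
      by (simp add: mult_ac)
    also have "\<dots> \<le> 1 * level_sum t k"
      using elim(2) level_sum_pos[of t k] by (intro mult_right_mono) auto
    finally show ?case
      by simp
  qed
qed

lemma hausdorff_dim_attractor: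
  assumes osc: "open_set_condition I Jw"
    and lim: "(\<lambda>k. ln (min_scale I \<phi> J k) / ln (max_scale I \<phi> J k)) \<longlonglongrightarrow> 0"
  shows "hausdorff_dim (attractor I Jw) = lower_pressure_zero I \<phi> J"
proof (rule antisym)
  show "hausdorff_dim (attractor I Jw) \<le> lower_pressure_zero I \<phi> J"
    unfolding hausdorff_dim_def lower_pressure_zero_def
    using pressure_neg_imp_pos hausdorff_measure_attractor_zero
    by (intro Inf_superset_mono image_mono) (auto intro: less_imp_le)
  show "lower_pressure_zero I \<phi> J \<le> hausdorff_dim (attractor I Jw)"
    unfolding hausdorff_dim_def
  proof (rule INF_greatest)
    fix s assume "s \<in> {s. 0 \<le> s \<and> hausdorff_measure s (attractor I Jw) = 0}"
    then have s: "0 \<le> s" "hausdorff_measure s (attractor I Jw) = 0"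
      by auto
    show "lower_pressure_zero I \<phi> J \<le> ereal s"
    proof (rule ccontr)
      assume "\<not> lower_pressure_zero I \<phi> J \<le> ereal s"
      then obtain t' where t': "ereal s < ereal t'" "ereal t' < lower_pressure_zero I \<phi> J"
        using ereal_dense2 by (meson linorder_not_le)
      have "\<not> lower_pressure I \<phi> J t' < 0"
      proof
        assume "lower_pressure I \<phi> J t' < 0"
        then have "lower_pressure_zero I \<phi> J \<le> ereal t'"
          unfolding lower_pressure_zero_def by (intro INF_lower) simp
        then show False
          using t'(2) by simp
      qed
      then have "eventually (\<lambda>k. 1 \<le> level_sum ((s + t') / 2) k) sequentially"
        using t'(1) by (intro eventually_level_sum_ge_1[of t']) auto
      then have "hausdorff_measure s (attractor I Jw) \<noteq> 0"
        using t'(1) by (intro hausdorff_measure_attractor_nonzero[OF osc lim s(1), of "(s + t') / 2"]) auto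
      then show False
        using s(2) by blast
    qed
  qed
qed

end

theorem theorem2p3:
  fixes I :: "nat \<Rightarrow> 'i set"
    and \<phi> :: "nat \<Rightarrow> 'i \<Rightarrow> 'a::euclidean_space \<Rightarrow> 'a"
    and J :: "'a set"
    and Jw :: "'i list \<Rightarrow> 'a set"
  assumes "conformal_nonautonomous_ifs I \<phi> J Jw"
    and "open_set_condition I Jw"
    and "emeasure lebesgue (frontier J) = 0"
    and "(\<lambda>k. ln (min_scale I \<phi> J k) / ln (max_scale I \<phi> J k)) \<longlonglongrightarrow> 0"
  shows "hausdorff_dim (attractor I Jw) = lower_pressure_zero I \<phi> J"
proof -
  interpret conformal_nonautonomous_ifs I \<phi> J Jw
    by (rule assms(1))
  obtain V C where V: "open V" "connected V" "J \<subseteq> V"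
      "\<forall>k\<ge>1. \<forall>i\<in>I k. C1_conformal_diffeo_into V (\<phi> k i)" "C \<ge> 1"
      "\<forall>l\<ge>1. \<forall>k\<ge>l. \<forall>u \<in> words I l k. \<forall>x\<in>V. \<forall>y\<in>V.
         deriv_scale (word_map \<phi> l u) x \<le> C * deriv_scale (word_map \<phi> l u) y"
    using conformal by blast
  obtain c where c: "0 < c" "c < 1"
      "\<forall>k\<ge>1. \<forall>i\<in>I k. \<forall>x\<in>J. \<forall>y\<in>J. dist (\<phi> k i x) (\<phi> k i y) \<le> c * dist x y"
    using contraction by blast
  interpret conformal_ifs I \<phi> J Jw V C c
    by unfold_locales (use V c in blast)+
  show ?thesis
    using hausdorff_dim_attractor assms(2,4) .
qed

end
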